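(* Consider $f(x)=\frac1n\sum_{i=1}^n f_i(x)$, $x\in\mathbb{R}^d$. Assume there exists $f_*\in\mathbb{R}$ with $f(x)\ge f_*$ for all $x\in\mathbb{R}^d$; that $f_i$ is $L_i$-smooth for all $i\in\{1,\dots,n\}$, i.e. $\|\nabla f_i(x)-\nabla f_i(y)\|\le L_i\|x-y\|$ for all $x,y\in\mathbb{R}^d$; and that $f$ satisfies the Polyak–Łojasiewicz condition with parameter $\mu$, i.e. $\|\nabla f(x)\|^2\ge2\mu(f(x)-f(x^* ))$ for all $x\in\mathbb{R}^d$, where $x^*=\arg\min_{x\in\mathbb{R}^d}f(x)$. Let $\mathcal{Q}$ be a quantization operator with parameter $\omega$ and expected density $\zeta_{\mathcal Q}$, let $p\in(0,1]$, and let $$\gamma\le\min\left\{\frac{1}{L\left(1+\sqrt{\frac{2(1-p)\omega}{pn}}\right)},\frac{p}{2\mu}\right\},\qquad L^2=\frac1n\sum_{i=1}^nL_i^2.$$ Then after $K$ iterations of MARINA we have $$\mathbf{E}\left[f(x^K)-f(x^* )\right]\le(1-\gamma\mu)^K\Delta_0,$$ where $\Delta_0=f(x^0)-f(x^* )$. That is, after $$K=\mathcal{O}\left(\max\left\{\frac1p,\frac L\mu\left(1+\sqrt{\frac{(1-p)\omega}{pn}}\right)\right\}\log\frac{\Delta_0}{\varepsilon}\right)$$ iterations MARINA produces such a point $x^K$ that $\mathbf{E}[f(x^K)-f(x^* )]\le\varepsilon$. Moreover, under an assumption that the communication cost is proportional to the number of non-zero components of transmitted vectors from workers to the server, the expected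 total communication cost per worker equals $$d+K(pd+(1-p)\zeta_{\mathcal Q})=\mathcal{O}\left(d+\max\left\{\frac1p,\frac L\mu\left(1+\sqrt{\frac{(1-p)\omega}{pn}}\right)\right\}(pd+(1-p)\zeta_{\mathcal Q})\log\frac{\Delta_0}{\varepsilon}\right).$$
   Context: $\|\cdot\|$ is the Euclidean norm; $\|y\|_0$ is the number of non-zero components of $y\in\mathbb{R}^d$. Quantization operator: a stochastic mapping $\mathcal{Q}:\mathbb{R}^d\to\mathbb{R}^d$ for which there is $\omega>0$ with $\mathbf{E}[\mathcal{Q}(x)]=x$ and $\mathbf{E}[\|\mathcal{Q}(x)-x\|^2]\le\omega\|x\|^2$ for any $x\in\mathbb{R}^d$. Its expected density is $\zeta_{\mathcal Q}=\sup_{x\in\mathbb{R}^d}\mathbf{E}[\|\mathcal{Q}(x)\|_0]$. MARINA (a distributed method with $n$ workers, worker $i$ having access to $f_i$, and a server; input: starting point $x^0$, stepsize $\gamma$, probability $p\in(0,1]$, number of iterations $K$): initialize $g^0=\nabla f(x^0)$. For $k=0,\dots,K-1$: sample $c_k\sim\mathrm{Bernoulli}(p)$ and broadcast $g^k$ to all workers; each worker $i=1,\dots,n$ in parallel computes $x^{k+1}=x^k-\gamma g^k$ and sets $g_i^{k+1}=\nabla f_i(x^{k+1})$ if $c_k=1$, and $g_i^{k+1}=g^k+\mathcal{Q}(\nabla f_i(x^{k+1})-\nabla f_i(x^k))$ otherwise; then $g^{k+1}=\frac1n\sum_{i=1}^n g_i^{k+1}$. The point considered here is the last iterate $x^K$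.
   Formalization: The O-bounds are for γ equal to the stated minimum and ε ≤ Δ₀/2. The cost equality charges d per full gradient and ζ_Q per quantized vector; the literal expected count of non-zeros is shown ≤ this, with equality if gradients are dense and Q attains ζ_Q. *)

theory Defs
  imports "HOL-Probability.Probability"
begin

definition nnz :: "real ^ 'd::finite \<Rightarrow> nat" where
  "nnz y = card {i. y $ i \<noteq> 0}"

definition grad :: "('v::real_inner \<Rightarrow> real) \<Rightarrow> 'v \<Rightarrow> 'v" where
  "grad f x = (THE D. GDERIV f x :> D)"

definition smooth_with :: "real \<Rightarrow> ('v::real_inner \<Rightarrow> real) \<Rightarrow> bool" where
  "smooth_with L f \<longleftrightarrow>
     (\<forall>x. f differentiable (at x)) \<and>
     (\<forall>x y. norm (grad f x - grad f y) \<le> L * norm (x - y))"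

definition polyak_lojasiewicz :: "real \<Rightarrow> ('v::real_inner \<Rightarrow> real) \<Rightarrow> 'v \<Rightarrow> bool" where
  "polyak_lojasiewicz \<mu> f xstar \<longleftrightarrow>
     0 < \<mu> \<and> is_arg_min f (\<lambda>_. True) xstar \<and>
     (\<forall>x. (norm (grad f x))\<^sup>2 \<ge> 2 * \<mu> * (f x - f xstar))"

definition average_fun :: "nat \<Rightarrow> (nat \<Rightarrow> 'v \<Rightarrow> real) \<Rightarrow> 'v \<Rightarrow> real" where
  "average_fun n fi x = (\<Sum>i=1..n. fi i x) / real n"

text \<open>
  A stochastic mapping of \<open>real ^ 'd\<close> is a jointly measurable function \<open>Q s x\<close> of its argument
  \<open>x\<close> and of a random seed \<open>s\<close> whose law is the probability measure \<open>S\<close>.  The integrability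
  requirements say that the expectations exist; the Bochner integral of a
  non-integrable function is 0 by convention.
\<close>

definition quantization_operator ::
  "'s measure \<Rightarrow> ('s \<Rightarrow> real ^ 'd::finite \<Rightarrow> real ^ 'd) \<Rightarrow> real \<Rightarrow> bool" where
  "quantization_operator S Q \<omega> \<longleftrightarrow>
     prob_space S \<and>
     (\<lambda>(s, x). Q s x) \<in> borel_measurable (S \<Otimes>\<^sub>M borel) \<and>
     0 < \<omega> \<and>
     (\<forall>x. integrable S (\<lambda>s. Q s x) \<and> (\<integral>s. Q s x \<partial>S) = x) \<and>
     (\<forall>x. integrable S (\<lambda>s. (norm (Q s x - x))\<^sup>2) \<and>
          (\<integral>s. (norm (Q s x - x))\<^sup>2 \<partial>S) \<le> \<omega> * (norm x)\<^sup>2)"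

definition expected_density ::
  "'s measure \<Rightarrow> ('s \<Rightarrow> real ^ 'd::finite \<Rightarrow> real ^ 'd) \<Rightarrow> real" where
  "expected_density S Q = (SUP x. \<integral>s. real (nnz (Q s x)) \<partial>S)"

text \<open>
  MARINA along one realisation of its randomness: \<open>c k\<close> is the coin of iteration \<open>k\<close>, and
  \<open>s k i\<close> is the seed with which worker \<open>i\<close> evaluates \<open>Q\<close> in iteration \<open>k\<close>.
  The state after \<open>k\<close> iterations is the pair of the iterate and its gradient estimator.
\<close>

primrec marina ::
  "nat \<Rightarrow> (nat \<Rightarrow> real ^ 'd::finite \<Rightarrow> real) \<Rightarrow> ('s \<Rightarrow> real ^ 'd \<Rightarrow> real ^ 'd) \<Rightarrow> real \<Rightarrow> real ^ 'd
     \<Rightarrow> (nat \<Rightarrow> bool) \<Rightarrow> (nat \<Rightarrow> nat \<Rightarrow> 's) \<Rightarrow> nat \<Rightarrow> (real ^ 'd) \<times> (real ^ 'd)" where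
  "marina n fi Q \<gamma> x0 c s 0 = (x0, grad (average_fun n fi) x0)"
| "marina n fi Q \<gamma> x0 c s (Suc k) =
     (let (x, g) = marina n fi Q \<gamma> x0 c s k;
          x' = x - \<gamma> *\<^sub>R g;
          gi = (\<lambda>i. if c k then grad (fi i) x'
                    else g + Q (s k i) (grad (fi i) x' - grad (fi i) x))
      in (x', (1 / real n) *\<^sub>R (\<Sum>i=1..n. gi i)))"

definition marina_x ::
  "nat \<Rightarrow> (nat \<Rightarrow> real ^ 'd::finite \<Rightarrow> real) \<Rightarrow> ('s \<Rightarrow> real ^ 'd \<Rightarrow> real ^ 'd) \<Rightarrow> real \<Rightarrow> real ^ 'd
     \<Rightarrow> (nat \<Rightarrow> bool) \<Rightarrow> (nat \<Rightarrow> nat \<Rightarrow> 's) \<Rightarrow> nat \<Rightarrow> real ^ 'd" where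
  "marina_x n fi Q \<gamma> x0 c s k = fst (marina n fi Q \<gamma> x0 c s k)"

text \<open>
  The joint law of all coins and all seeds is the product law: the coins are Bernoulli with
  parameter \<open>p\<close>, the seeds have law \<open>S\<close>, and all of them (over iterations and workers) are
  mutually independent.
\<close>

definition marina_sample_space ::
  "'s measure \<Rightarrow> real \<Rightarrow> nat \<Rightarrow> (nat \<Rightarrow> bool \<times> (nat \<Rightarrow> 's)) measure" where
  "marina_sample_space S p n =
     (\<Pi>\<^sub>M k\<in>UNIV. measure_pmf (bernoulli_pmf p) \<Otimes>\<^sub>M (\<Pi>\<^sub>M i\<in>{1..n}. S))"

definition marina_randomness ::
  "'a measure \<Rightarrow> 's measure \<Rightarrow> real \<Rightarrow> nat \<Rightarrow> ('a \<Rightarrow> nat \<Rightarrow> bool) \<Rightarrow> ('a \<Rightarrow> nat \<Rightarrow> nat \<Rightarrow> 's) \<Rightarrow> bool" where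
  "marina_randomness M S p n c \<xi> \<longleftrightarrow>
     prob_space M \<and>
     (\<lambda>w k. (c w k, \<lambda>i\<in>{1..n}. \<xi> w k i)) \<in> measurable M (marina_sample_space S p n) \<and>
     distr M (marina_sample_space S p n) (\<lambda>w k. (c w k, \<lambda>i\<in>{1..n}. \<xi> w k i))
       = marina_sample_space S p n"

text \<open>
  The number of non-zero components sent by worker \<open>i\<close> to the server in \<open>K\<close> iterations.  The
  leading term is its gradient at \<open>x0\<close>, which the server needs for the initial estimator.
  When the coin is 0 only the quantized difference is sent, since the server already knows
  the current estimator.
\<close>

definition marina_sent ::
  "nat \<Rightarrow> (nat \<Rightarrow> real ^ 'd::finite \<Rightarrow> real) \<Rightarrow> ('s \<Rightarrow> real ^ 'd \<Rightarrow> real ^ 'd) \<Rightarrow> real \<Rightarrow> real ^ 'd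
     \<Rightarrow> (nat \<Rightarrow> bool) \<Rightarrow> (nat \<Rightarrow> nat \<Rightarrow> 's) \<Rightarrow> nat \<Rightarrow> nat \<Rightarrow> nat" where
  "marina_sent n fi Q \<gamma> x0 c s i K =
     nnz (grad (fi i) x0) +
     (\<Sum>k<K. let x = marina_x n fi Q \<gamma> x0 c s k; x' = marina_x n fi Q \<gamma> x0 c s (Suc k)
             in if c k then nnz (grad (fi i) x')
                else nnz (Q (s k i) (grad (fi i) x' - grad (fi i) x)))"

text \<open>
  The nominal price of the same transmissions: every vector is charged the expected density of
  the operator that produced it, which is the identity for an uncompressed gradient and \<open>Q\<close>
  for a quantized difference.  The price is the same for every worker.
\<close>

definition marina_nominal_cost ::
  "'s measure \<Rightarrow> ('s \<Rightarrow> real ^ 'd::finite \<Rightarrow> real ^ 'd) \<Rightarrow> (nat \<Rightarrow> bool) \<Rightarrow> nat \<Rightarrow> real" where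
  "marina_nominal_cost S Q c K =
     expected_density S (\<lambda>_ y :: real ^ 'd. y) +
     (\<Sum>k<K. if c k then expected_density S (\<lambda>_ y :: real ^ 'd. y) else expected_density S Q)"

end

theory Submission
  imports Defs
begin

text \<open>
  The Lyapunov function \<open>f x - f x* + (\<gamma> / p) |g - grad f x|\<^sup>2\<close> contracts in expectation by the factor
  \<open>1 - \<gamma> \<mu>\<close> in every round, for each fixed state \<open>(x, g)\<close>.  The descent lemma bounds the first summand.
  In the second, the error vanishes when the coin is 1, while otherwise the centred, independent
  quantization errors add \<open>\<omega> L\<^sup>2 |x' - x|\<^sup>2 / n\<close> at most; the bound on \<open>\<gamma>\<close> makes the negative
  \<open>|x' - x|\<^sup>2\<close> term of the descent lemma absorb this.  Since the state before a round is independent of the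
  coin and the seeds of that round, Fubini's theorem carries over the fixed-state bounds, for the
  Lyapunov function and for the communication cost alike.
\<close>

section \<open>Gradients of smooth functions\<close>

text \<open>The weight \<open>\<gamma> / p\<close> balances two losses. A round scales the squared
  error by \<open>1 - p\<close>, so the weighted error drops by \<open>\<gamma>\<close> times the
  error. Half of this drop pays the error term of the descent inequality; the other half covers the
  factor \<open>1 - \<gamma> * \<mu>\<close>, because the second stepsize bound gives
  \<open>\<gamma> * \<mu> \<le> p / 2\<close>. Integrability of the Lyapunov function along a run is
  not known beforehand, since no uniform bound on the iterates is available. The convergence half
  therefore uses nonnegative integrals, for which Tonelli asks for measurability alone, and
  integrability of the suboptimality comes out at the end from a finite bound. Costs are bounded by
  the dimension, so the Bochner integral serves them directly. On the cost side the obstacle is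
  exactness: \<open>expected_density S Q\<close> is a supremum over all inputs, while a run meets
  only particular ones.\<close>

lemma GDERIV_unique:
  assumes "GDERIV f x :> D" "GDERIV f x :> E"
  shows "D = E"
proof -
  have "(\<lambda>h. h \<bullet> D) = (\<lambda>h. h \<bullet> E)"
    using assms unfolding gderiv_def by (rule has_derivative_unique)
  then have "(D - E) \<bullet> D = (D - E) \<bullet> E"
    by (rule fun_cong)
  then have "(D - E) \<bullet> (D - E) = 0"
    by (simp add: inner_diff_right)
  then show ?thesis by simp
qed

text \<open>\<open>grad\<close> is a definite description; uniqueness lets a computed derivative
  determine its value.\<close>

lemma grad_eqI: "GDERIV f x :> D \<Longrightarrow> grad f x = D"
  unfolding grad_def by (blast intro: GDERIV_unique)

text \<open>Riesz representation in finite dimension: a linear form is the inner product with the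
  vector whose coordinates are its values on \<open>Basis\<close>.\<close>

lemma differentiable_imp_GDERIV:
  fixes f :: "'v::euclidean_space \<Rightarrow> real"
  assumes "f differentiable (at x)"
  shows "GDERIV f x :> grad f x"
proof -
  obtain f' where f': "(f has_derivative f') (at x)"
    using assms by (auto simp: differentiable_def)
  then interpret bounded_linear f' by (rule has_derivative_bounded_linear)
  have "f' h = h \<bullet> (\<Sum>b\<in>Basis. f' b *\<^sub>R b)" for h
  proof -
    have "f' h = f' (\<Sum>b\<in>Basis. (h \<bullet> b) *\<^sub>R b)" by (simp add: euclidean_representation)
    also have "\<dots> = (\<Sum>b\<in>Basis. (h \<bullet> b) * f' b)" by (simp add: sum scaleR)
    finally show ?thesis by (simp add: inner_sum_right mult.commute)
  qed
  then have "f' = (\<lambda>h. h \<bullet> (\<Sum>b\<in>Basis. f' b *\<^sub>R b))"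
    by (rule ext)
  then have "GDERIV f x :> (\<Sum>b\<in>Basis. f' b *\<^sub>R b)"
    unfolding gderiv_def using f' by metis
  then show ?thesis using grad_eqI by metis
qed

lemma GDERIV_sum:
  assumes "\<And>i. i \<in> I \<Longrightarrow> GDERIV (f i) x :> D i"
  shows "GDERIV (\<lambda>y. \<Sum>i\<in>I. f i y) x :> (\<Sum>i\<in>I. D i)"
  using assms unfolding gderiv_def inner_sum_right by (intro has_derivative_sum)

lemma GDERIV_average_fun:
  fixes fi :: "nat \<Rightarrow> 'v::euclidean_space \<Rightarrow> real"
  assumes "\<And>i. i \<in> {1..n} \<Longrightarrow> fi i differentiable (at x)"
  shows "GDERIV (average_fun n fi) x :> (1 / real n) *\<^sub>R (\<Sum>i=1..n. grad (fi i) x)"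
proof -
  have "GDERIV (\<lambda>y. \<Sum>i=1..n. fi i y) x :> (\<Sum>i=1..n. grad (fi i) x)"
    using assms by (intro GDERIV_sum differentiable_imp_GDERIV)
  from GDERIV_mult[OF GDERIV_const[of "1 / real n"] this]
  show ?thesis by (simp add: average_fun_def[abs_def] field_simps)
qed

lemma grad_average_fun:
  fixes fi :: "nat \<Rightarrow> 'v::euclidean_space \<Rightarrow> real"
  assumes "\<And>i. i \<in> {1..n} \<Longrightarrow> fi i differentiable (at x)"
  shows "grad (average_fun n fi) x = (1 / real n) *\<^sub>R (\<Sum>i=1..n. grad (fi i) x)"
  using GDERIV_average_fun[OF assms] by (rule grad_eqI)

text \<open>The triangle inequality yields the arithmetic mean of the \<open>Li\<close> as a
  Lipschitz constant, and Cauchy-Schwarz bounds it by the quadratic mean \<open>L\<close>.\<close>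

lemma smooth_with_average_fun:
  fixes fi :: "nat \<Rightarrow> 'v::euclidean_space \<Rightarrow> real"
  assumes n: "1 \<le> n" and sm: "\<And>i. i \<in> {1..n} \<Longrightarrow> smooth_with (Li i) (fi i)"
    and L: "0 \<le> L" "L\<^sup>2 = (\<Sum>i=1..n. (Li i)\<^sup>2) / real n"
  shows "smooth_with L (average_fun n fi)"
proof -
  have diff: "fi i differentiable (at x)" if "i \<in> {1..n}" for i x
    using sm[OF that] by (simp add: smooth_with_def)
  have "norm (grad (average_fun n fi) x - grad (average_fun n fi) y) \<le> L * norm (x - y)" for x y
  proof -
    have "grad (average_fun n fi) x - grad (average_fun n fi) y
        = (1 / real n) *\<^sub>R (\<Sum>i=1..n. grad (fi i) x - grad (fi i) y)"
      by (simp only: grad_average_fun[OF diff] sum_subtractf scaleR_diff_right)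
    also have "norm \<dots> \<le> (\<Sum>i=1..n. Li i * norm (x - y)) / real n"
    proof -
      have "norm (\<Sum>i=1..n. grad (fi i) x - grad (fi i) y) \<le> (\<Sum>i=1..n. Li i * norm (x - y))"
        using sm unfolding smooth_with_def by (intro order_trans[OF norm_sum] sum_mono) blast
      then show ?thesis by (simp add: divide_right_mono)
    qed
    also have "\<dots> = ((\<Sum>i=1..n. Li i) / real n) * norm (x - y)"
      by (simp add: sum_distrib_right)
    also have "\<dots> \<le> L * norm (x - y)"
    proof (rule mult_right_mono)
      have "((\<Sum>i=1..n. Li i) / real n)\<^sup>2 \<le> (\<Sum>i=1..n. (Li i)\<^sup>2) * real n / (real n)\<^sup>2"
        using sum_squared_le_sum_of_squares[of Li "{1..n}"] by (simp add: power_divide divide_right_mono)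
      also have "\<dots> = L\<^sup>2" using n unfolding L(2) by (simp add: power2_eq_square[of "real n"])
      finally show "(\<Sum>i=1..n. Li i) / real n \<le> L" using L(1) by (rule power2_le_imp_le)
    qed simp
    finally show ?thesis .
  qed
  moreover have "average_fun n fi differentiable (at x)" for x
    using GDERIV_average_fun[of n fi x, OF diff] unfolding gderiv_def differentiable_def by blast
  ultimately show ?thesis by (simp add: smooth_with_def)
qed

lemma smooth_with_continuous_on_grad:
  fixes f :: "'v::real_inner \<Rightarrow> real"
  assumes "smooth_with L f"
  shows "continuous_on UNIV (grad f)"
proof (rule lipschitz_on_continuous_on)
  \<comment> \<open>\<open>lipschitz_on\<close> asks for a nonnegative constant, which
    \<open>smooth_with\<close> does not state; hence the absolute value.\<close>
  show "\<bar>L\<bar>-lipschitz_on UNIV (grad f)"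
    using assms unfolding smooth_with_def lipschitz_on_def dist_norm
    by (meson UNIV_I abs_ge_self abs_ge_zero mult_right_mono norm_ge_zero order_trans)
qed

lemma smooth_with_continuous_on:
  fixes f :: "'v::real_inner \<Rightarrow> real"
  assumes "smooth_with L f"
  shows "continuous_on UNIV f"
  using assms by (simp add: smooth_with_def continuous_at_imp_continuous_on differentiable_imp_continuous_within)

lemma smooth_with_descent:
  fixes f :: "'v::euclidean_space \<Rightarrow> real"
  assumes sm: "smooth_with L f"
  shows "f y \<le> f x + grad f x \<bullet> (y - x) + L / 2 * (norm (y - x))\<^sup>2"
proof -
  define v where "v = y - x"
  \<comment> \<open>Along the segment, \<open>h\<close> subtracts from \<open>f\<close> its linear
    part and the quadratic allowance. The Lipschitz bound makes \<open>h\<close> nonincreasing,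
    which replaces an integral of the gradient.\<close>
  define h where "h t = f (x + t *\<^sub>R v) - t * (grad f x \<bullet> v) - L / 2 * t\<^sup>2 * (norm v)\<^sup>2" for t
  have "h 1 \<le> h 0"
  proof (rule DERIV_nonpos_imp_nonincreasing[of 0 1])
    fix t :: real assume t: "0 \<le> t" "t \<le> 1"
    have "(f has_derivative (\<lambda>h. h \<bullet> grad f (x + t *\<^sub>R v))) (at (x + t *\<^sub>R v))"
      using sm differentiable_imp_GDERIV by (auto simp: smooth_with_def gderiv_def)
    then have "((\<lambda>t. f (x + t *\<^sub>R v)) has_derivative (\<lambda>s. (s *\<^sub>R v) \<bullet> grad f (x + t *\<^sub>R v))) (at t)"
      by (rule has_derivative_compose[rotated]) (auto intro!: derivative_eq_intros)
    then have 1: "((\<lambda>t. f (x + t *\<^sub>R v)) has_real_derivative (v \<bullet> grad f (x + t *\<^sub>R v))) (at t)"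
      by (simp add: has_field_derivative_def mult.commute[of _ "v \<bullet> _"])
    have "(h has_real_derivative (v \<bullet> grad f (x + t *\<^sub>R v) - grad f x \<bullet> v - L * t * (norm v)\<^sup>2)) (at t)"
      unfolding h_def by (rule 1 derivative_eq_intros refl)+ simp
    moreover have "v \<bullet> grad f (x + t *\<^sub>R v) - grad f x \<bullet> v - L * t * (norm v)\<^sup>2 \<le> 0"
    proof -
      have "v \<bullet> grad f (x + t *\<^sub>R v) - grad f x \<bullet> v = (grad f (x + t *\<^sub>R v) - grad f x) \<bullet> v"
        by (simp add: inner_diff_right inner_commute[of _ v])
      also have "\<dots> \<le> norm (grad f (x + t *\<^sub>R v) - grad f x) * norm v"
        by (rule norm_cauchy_schwarz)
      also have "\<dots> \<le> (L * norm (t *\<^sub>R v)) * norm v"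
        using sm unfolding smooth_with_def by (intro mult_right_mono) (metis add_diff_cancel_left', simp)
      also have "\<dots> = L * t * (norm v)\<^sup>2" using t by (simp add: power2_eq_square)
      finally show ?thesis by simp
    qed
    ultimately show "\<exists>y. (h has_real_derivative y) (at t) \<and> y \<le> 0" by blast
  qed simp
  then show ?thesis by (simp add: h_def v_def)
qed

text \<open>Polarization in the descent inequality: twice the inner product of \<open>g\<close> and
  \<open>grad f x\<close> is the sum of their squared norms minus that of their difference. An
  arbitrary estimator \<open>g\<close> is thus charged only for its error.\<close>

lemma smooth_with_inexact_gradient_step:
  fixes f :: "'v::euclidean_space \<Rightarrow> real"
  assumes "smooth_with L f"
  shows "f (x - \<gamma> *\<^sub>R g) \<le> f x - \<gamma> / 2 * (norm (grad f x))\<^sup>2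
    - (\<gamma> / 2 - L * \<gamma>\<^sup>2 / 2) * (norm g)\<^sup>2 + \<gamma> / 2 * (norm (g - grad f x))\<^sup>2"
  using smooth_with_descent[OF assms, of "x - \<gamma> *\<^sub>R g" x]
  by (simp add: power2_norm_eq_inner inner_diff_left inner_diff_right inner_commute algebra_simps
      power2_eq_square[of \<gamma>])

section \<open>Stepsize and iteration count\<close>

text \<open>With \<open>t = \<gamma> * L\<close> and \<open>b = sqrt (2 * a)\<close> the hypothesis
  reads \<open>t * b \<le> 1 - t\<close>. Hence \<open>t * b\<close> lies between 0 and 1, and
  squaring it can only decrease it.\<close>

lemma marina_stepsize_bound:
  fixes L a \<gamma> :: real
  assumes "0 < L" "0 \<le> a" "0 < \<gamma>" "\<gamma> \<le> 1 / (L * (1 + sqrt (2 * a)))"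
  shows "2 * a * (\<gamma> * L)\<^sup>2 + \<gamma> * L \<le> 1"
proof -
  define b t where "b = sqrt (2 * a)" and "t = \<gamma> * L"
  have b: "0 \<le> b" "b\<^sup>2 = 2 * a" using assms by (simp_all add: b_def)
  have t: "0 \<le> t" using assms by (simp add: t_def)
  have "t * (1 + b) \<le> 1"
    using assms b by (simp add: t_def b_def field_simps add_pos_nonneg)
  then have "t * b \<le> 1 - t" by (simp add: algebra_simps)
  moreover have "0 \<le> t * b" using t b by simp
  ultimately have "(t * b)\<^sup>2 \<le> 1 - t"
    using mult_left_le[of "t * b" "t * b"] t unfolding power2_eq_square by linarith
  then show ?thesis using b by (simp add: t_def power_mult_distrib mult_ac)
qed

text \<open>Both arguments of the minimum give
  \<open>1 / (\<gamma> * \<mu>) \<le> 2 * \<kappa>\<close>, and \<open>1 - t \<le> exp (- t)\<close>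
  shows that \<open>l / (\<gamma> * \<mu>)\<close> iterations suffice, where \<open>l\<close> is the
  logarithm.\<close>

lemma complexity_bound:
  fixes \<gamma> \<mu> L a p \<Delta> \<epsilon> \<kappa> :: real
  assumes \<mu>: "0 < \<mu>" and L: "0 < L" and a: "0 \<le> a" and p: "0 < p" "p \<le> 1"
    and \<gamma>: "\<gamma> = min (1 / (L * (1 + sqrt (2 * a)))) (p / (2 * \<mu>))"
    and \<kappa>: "\<kappa> = max (1 / p) (L / \<mu> * (1 + sqrt a))"
    and \<epsilon>: "0 < \<epsilon>" "\<epsilon> \<le> \<Delta> / 2"
  obtains K0 :: nat where "real K0 \<le> 4 * (\<kappa> * ln (\<Delta> / \<epsilon>))"
    and "\<And>K. K0 \<le> K \<Longrightarrow> (1 - \<gamma> * \<mu>) ^ K * \<Delta> \<le> \<epsilon>"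
proof -
  define l where "l = ln (\<Delta> / \<epsilon>)"
  have ratio: "2 \<le> \<Delta> / \<epsilon>" using \<epsilon> by (simp add: field_simps)
  then have "ln 2 \<le> l" unfolding l_def by (subst ln_le_cancel_iff) auto
  \<comment> \<open>With \<open>1 \<le> \<kappa>\<close> this gives
    \<open>1 \<le> 2 * (\<kappa> * l)\<close>, so the 1 lost by rounding up in \<open>K0\<close>
    turns the constant 2 into 4.\<close>
  then have l: "1 / 2 \<le> l" using ln2_ge_two_thirds by linarith
  have \<kappa>1: "1 \<le> \<kappa>" using p by (simp add: \<kappa> le_max_iff_disj)
  have sq: "0 < 1 + sqrt (2 * a)" using a by (simp add: add_pos_nonneg)
  have pos: "0 < \<gamma>" using \<mu> L p sq by (simp add: \<gamma>)
  have "1 \<le> 2 * \<kappa> * (\<gamma> * \<mu>)"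
  proof (cases "1 / (L * (1 + sqrt (2 * a))) \<le> p / (2 * \<mu>)")
    case True
    have "sqrt 2 * sqrt a \<le> 2 * sqrt a"
      using a by (intro mult_right_mono) (auto intro: real_le_lsqrt)
    then have "1 + sqrt (2 * a) \<le> 2 * (1 + sqrt a)"
      by (simp add: real_sqrt_mult)
    then have "L / \<mu> * (1 + sqrt (2 * a)) \<le> L / \<mu> * (2 * (1 + sqrt a))"
      using L \<mu> by (intro mult_left_mono) auto
    also have "\<dots> = 2 * (L / \<mu> * (1 + sqrt a))" by simp
    also have "\<dots> \<le> 2 * \<kappa>" unfolding \<kappa> by (intro mult_left_mono) auto
    finally have "L / \<mu> * (1 + sqrt (2 * a)) * (\<gamma> * \<mu>) \<le> 2 * \<kappa> * (\<gamma> * \<mu>)"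
      using pos \<mu> by (intro mult_right_mono) auto
    moreover have "L / \<mu> * (1 + sqrt (2 * a)) * (\<gamma> * \<mu>) = 1"
      using True L \<mu> sq by (simp add: \<gamma> min_def)
    ultimately show ?thesis by simp
  next
    case False
    then have "\<gamma> * \<mu> = p / 2" using \<mu> by (simp add: \<gamma> min_def)
    moreover have "1 / p \<le> \<kappa>" by (simp add: \<kappa>)
    ultimately show ?thesis using p by (simp add: field_simps)
  qed
  then have inv: "1 / (\<gamma> * \<mu>) \<le> 2 * \<kappa>" using pos \<mu> by (simp add: field_simps)
  define K0 where "K0 = nat \<lceil>l / (\<gamma> * \<mu>)\<rceil>"
  have nonneg: "0 \<le> l / (\<gamma> * \<mu>)" using l pos \<mu> by simp
  have "\<gamma> * \<mu> \<le> p / (2 * \<mu>) * \<mu>" using \<mu> by (intro mult_right_mono) (auto simp: \<gamma>)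
  then have \<gamma>\<mu>: "\<gamma> * \<mu> \<le> 1" using \<mu> p by simp
  show thesis
  proof
    have "real K0 \<le> l / (\<gamma> * \<mu>) + 1" unfolding K0_def using nonneg by linarith
    also have "l / (\<gamma> * \<mu>) \<le> l * (2 * \<kappa>)"
      using mult_left_mono[OF inv, of l] l by simp
    finally have "real K0 \<le> 2 * (\<kappa> * l) + 1" by (simp add: mult_ac)
    moreover have "1 / 2 \<le> \<kappa> * l" using mult_mono[OF \<kappa>1 l] \<kappa>1 by simp
    ultimately have "real K0 \<le> 4 * (\<kappa> * l)" by linarith
    then show "real K0 \<le> 4 * (\<kappa> * ln (\<Delta> / \<epsilon>))" by (simp add: l_def)
  next
    fix K :: nat assume K: "K0 \<le> K"
    have "l / (\<gamma> * \<mu>) \<le> real K" using K nonneg unfolding K0_def by linarith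
    then have "l \<le> \<gamma> * \<mu> * real K" using pos \<mu> by (simp add: field_simps)
    have "(1 - \<gamma> * \<mu>) ^ K \<le> exp (- (\<gamma> * \<mu>)) ^ K"
      using exp_ge_add_one_self[of "- (\<gamma> * \<mu>)"] \<gamma>\<mu> by (intro power_mono) auto
    also have "\<dots> = exp (- (\<gamma> * \<mu> * real K))" by (simp add: mult.commute flip: exp_of_nat_mult)
    also have "\<dots> \<le> exp (- l)" using \<open>l \<le> _\<close> by simp
    also have "\<dots> = \<epsilon> / \<Delta>" using \<epsilon> ratio by (simp add: l_def exp_minus)
    finally have "(1 - \<gamma> * \<mu>) ^ K * \<Delta> \<le> \<epsilon> / \<Delta> * \<Delta>"
      using \<epsilon> by (intro mult_right_mono) auto
    then show "(1 - \<gamma> * \<mu>) ^ K * \<Delta> \<le> \<epsilon>" using \<epsilon> by simp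
  qed
qed

section \<open>Expected density\<close>

lemma nnz_le_CARD: "nnz (y :: real ^ 'd::finite) \<le> CARD('d)"
  unfolding nnz_def by (intro card_mono) auto

lemma borel_measurable_nnz [measurable]:
  "(\<lambda>y :: real ^ 'd::finite. real (nnz y)) \<in> borel_measurable borel"
proof -
  have "real (nnz y) = (\<Sum>i\<in>UNIV. if y $ i \<noteq> 0 then 1 else 0)" for y :: "real ^ 'd"
    by (simp add: nnz_def sum.If_cases)
  then show ?thesis by simp
qed

context
  fixes S :: "'s measure" and Q :: "'s \<Rightarrow> real ^ 'd::finite \<Rightarrow> real ^ 'd"
  assumes S: "prob_space S" and Q: "\<And>x. (\<lambda>s. Q s x) \<in> borel_measurable S"
begin

interpretation prob_space S by (rule S)

lemma expected_nnz_le_CARD: "(\<integral>s. real (nnz (Q s x)) \<partial>S) \<le> real CARD('d)"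
proof -
  note [measurable] = Q
  have "(\<integral>s. real (nnz (Q s x)) \<partial>S) \<le> (\<integral>s. real CARD('d) \<partial>S)"
    by (intro integral_mono integrable_const_bound[where B = "real CARD('d)"]) (auto simp: nnz_le_CARD)
  then show ?thesis by (simp add: prob_space)
qed

text \<open>A real supremum dominates its members only over a set that is bounded above; the
  dimension is such a bound.\<close>

lemma expected_nnz_le_expected_density: "(\<integral>s. real (nnz (Q s x)) \<partial>S) \<le> expected_density S Q"
  unfolding expected_density_def
  by (intro cSUP_upper bdd_aboveI2[where M = "real CARD('d)"] expected_nnz_le_CARD) simp

lemma expected_density_nonneg: "0 \<le> expected_density S Q"
  using expected_nnz_le_expected_density[of 0] by (rule order_trans[rotated]) simp

end

lemma expected_density_identity:
  assumes "prob_space S"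
  shows "expected_density S (\<lambda>_ y :: real ^ 'd::finite. y) = real CARD('d)"
proof (rule antisym)
  interpret prob_space S by (rule assms)
  show "expected_density S (\<lambda>_ y :: real ^ 'd. y) \<le> real CARD('d)"
    unfolding expected_density_def by (rule cSUP_least) (auto simp: prob_space nnz_le_CARD)
  \<comment> \<open>The all-ones vector \<open>1\<close> has no zero component and attains the
    supremum.\<close>
  show "real CARD('d) \<le> expected_density S (\<lambda>_ y :: real ^ 'd. y)"
    using expected_nnz_le_expected_density[OF assms, of "\<lambda>_ y :: real ^ 'd. y" 1]
    by (simp add: prob_space nnz_def)
qed

section \<open>Second moments of independent centred sums\<close>

text \<open>The cross term \<open>2 * (b \<bullet> Y s)\<close> of the expanded square has mean
  0.\<close>

lemma nn_integral_norm_add_centred: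
  fixes Y :: "'s \<Rightarrow> 'v::euclidean_space"
  assumes "prob_space S" and Y: "integrable S Y" "(\<integral>s. Y s \<partial>S) = 0" "integrable S (\<lambda>s. (norm (Y s))\<^sup>2)"
  shows "(\<integral>\<^sup>+ s. ennreal ((norm (b + Y s))\<^sup>2) \<partial>S) = ennreal ((norm b)\<^sup>2 + (\<integral>s. (norm (Y s))\<^sup>2 \<partial>S))"
proof -
  interpret prob_space S by fact
  have eq: "(norm (b + Y s))\<^sup>2 = (norm b)\<^sup>2 + 2 * (b \<bullet> Y s) + (norm (Y s))\<^sup>2" for s
    by (simp add: power2_norm_eq_inner inner_add_left inner_add_right inner_commute)
  have int: "integrable S (\<lambda>s. (norm b)\<^sup>2 + 2 * (b \<bullet> Y s) + (norm (Y s))\<^sup>2)"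
    using Y by simp
  have "(\<integral>\<^sup>+ s. ennreal ((norm (b + Y s))\<^sup>2) \<partial>S) = ennreal (\<integral>s. (norm (b + Y s))\<^sup>2 \<partial>S)"
    using int by (intro nn_integral_eq_integral) (simp_all add: eq[symmetric])
  also have "(\<integral>s. (norm (b + Y s))\<^sup>2 \<partial>S) = (norm b)\<^sup>2 + (\<integral>s. (norm (Y s))\<^sup>2 \<partial>S)"
    unfolding eq using Y by (simp add: prob_space)
  finally show ?thesis .
qed

text \<open>Induction over \<open>I\<close>, integrating the seeds other than \<open>i\<close>
  first. For a fixed value \<open>y\<close> of seed \<open>i\<close>, the summand
  \<open>Y i y\<close> joins the shift, which is why \<open>a\<close> is generalised; integrating
  over \<open>y\<close> then falls to the centred case. Independence enters as the product
  measure.\<close>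

lemma nn_integral_norm_add_independent_sum_le:
  fixes Y :: "'i \<Rightarrow> 's \<Rightarrow> 'v::euclidean_space"
  assumes "prob_space S" and "finite I"
    and Y: "\<And>i. i \<in> I \<Longrightarrow> integrable S (Y i)" "\<And>i. i \<in> I \<Longrightarrow> (\<integral>s. Y i s \<partial>S) = 0"
      "\<And>i. i \<in> I \<Longrightarrow> integrable S (\<lambda>s. (norm (Y i s))\<^sup>2)"
      "\<And>i. i \<in> I \<Longrightarrow> (\<integral>s. (norm (Y i s))\<^sup>2 \<partial>S) \<le> v i"
  shows "(\<integral>\<^sup>+ s. ennreal ((norm (a + (\<Sum>i\<in>I. Y i (s i))))\<^sup>2) \<partial>(\<Pi>\<^sub>M i\<in>I. S)) \<le> ennreal ((norm a)\<^sup>2 + (\<Sum>i\<in>I. v i))"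
  using \<open>finite I\<close> Y
proof (induction I arbitrary: a)
  case empty
  interpret P: prob_space "\<Pi>\<^sub>M i\<in>{}. S" by (intro prob_space_PiM assms)
  show ?case by (simp add: P.emeasure_space_1)
next
  case (insert i I)
  interpret prob_space S by fact
  interpret product_sigma_finite "\<lambda>_::'i. S" by unfold_locales
  have Ym [measurable]: "Y j \<in> borel_measurable S" if "j \<in> insert i I" for j
    using insert.prems(1)[OF that] by auto
  have vnn: "0 \<le> v j" if "j \<in> insert i I" for j
    using insert.prems(4)[OF that] by (rule order_trans[rotated]) simp
  have upd: "(\<Sum>j\<in>insert i I. Y j ((x(i := y)) j)) = Y i y + (\<Sum>j\<in>I. Y j (x j))" for x y
  proof -
    have "(\<Sum>j\<in>I. Y j ((x(i := y)) j)) = (\<Sum>j\<in>I. Y j (x j))"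
      using insert.hyps by (intro sum.cong) auto
    then show ?thesis using insert.hyps by simp
  qed
  have "(\<lambda>s. Y j (s j)) \<in> borel_measurable (\<Pi>\<^sub>M i\<in>insert i I. S)" if "j \<in> insert i I" for j
    using Ym[OF that] by (intro measurable_PiM_component_rev[OF that])
  then have [measurable]: "(\<lambda>s. \<Sum>j\<in>insert i I. Y j (s j)) \<in> borel_measurable (\<Pi>\<^sub>M i\<in>insert i I. S)"
    by (rule borel_measurable_sum)
  have "(\<integral>\<^sup>+ s. ennreal ((norm (a + (\<Sum>j\<in>insert i I. Y j (s j))))\<^sup>2) \<partial>(\<Pi>\<^sub>M i\<in>insert i I. S))
      = (\<integral>\<^sup>+ y. (\<integral>\<^sup>+ x. ennreal ((norm ((a + Y i y) + (\<Sum>j\<in>I. Y j (x j))))\<^sup>2) \<partial>(\<Pi>\<^sub>M i\<in>I. S)) \<partial>S)"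
    by (subst product_nn_integral_insert_rev[OF insert.hyps], measurable) (simp only: upd add.assoc)
  also have "\<dots> \<le> (\<integral>\<^sup>+ y. ennreal ((norm (a + Y i y))\<^sup>2 + (\<Sum>j\<in>I. v j)) \<partial>S)"
    by (intro nn_integral_mono insert.IH insert.prems) auto
  also have "\<dots> = (\<integral>\<^sup>+ y. ennreal ((norm (a + Y i y))\<^sup>2) \<partial>S) + ennreal (\<Sum>j\<in>I. v j)"
    using vnn by (simp add: ennreal_plus sum_nonneg nn_integral_add emeasure_space_1)
  also have "\<dots> = ennreal ((norm a)\<^sup>2 + (\<integral>s. (norm (Y i s))\<^sup>2 \<partial>S)) + ennreal (\<Sum>j\<in>I. v j)"
    using insert.prems by (subst nn_integral_norm_add_centred) (auto intro: assms)
  also have "\<dots> \<le> ennreal ((norm a)\<^sup>2 + v i) + ennreal (\<Sum>j\<in>I. v j)"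
    using insert.prems(4)[of i] by (intro add_right_mono ennreal_leI) simp
  also have "\<dots> = ennreal ((norm a)\<^sup>2 + (\<Sum>j\<in>insert i I. v j))"
    using vnn insert.hyps by (subst ennreal_plus[symmetric]) (auto simp: sum_nonneg add.assoc)
  finally show ?case .
qed

section \<open>MARINA as a random dynamical system\<close>

text \<open>Coin and seeds of a round form one argument, so that a run is a deterministic system
  driven by an i.i.d. sequence.\<close>

definition marina_step ::
  "nat \<Rightarrow> (nat \<Rightarrow> real ^ 'd::finite \<Rightarrow> real) \<Rightarrow> ('s \<Rightarrow> real ^ 'd \<Rightarrow> real ^ 'd) \<Rightarrow> real
     \<Rightarrow> (real ^ 'd) \<times> (real ^ 'd) \<Rightarrow> bool \<times> (nat \<Rightarrow> 's) \<Rightarrow> (real ^ 'd) \<times> (real ^ 'd)" where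
  "marina_step n fi Q \<gamma> = (\<lambda>(x, g) (b, s). let x' = x - \<gamma> *\<^sub>R g in
     (x', (1 / real n) *\<^sub>R (\<Sum>i=1..n. if b then grad (fi i) x'
        else g + Q (s i) (grad (fi i) x' - grad (fi i) x))))"

definition marina_step_cost ::
  "(nat \<Rightarrow> real ^ 'd::finite \<Rightarrow> real) \<Rightarrow> ('s \<Rightarrow> real ^ 'd \<Rightarrow> real ^ 'd) \<Rightarrow> real \<Rightarrow> nat
     \<Rightarrow> (real ^ 'd) \<times> (real ^ 'd) \<Rightarrow> bool \<times> (nat \<Rightarrow> 's) \<Rightarrow> real" where
  "marina_step_cost fi Q \<gamma> i = (\<lambda>(x, g) (b, s). let x' = x - \<gamma> *\<^sub>R g in
     real (if b then nnz (grad (fi i) x') else nnz (Q (s i) (grad (fi i) x' - grad (fi i) x))))"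

definition marina_path ::
  "nat \<Rightarrow> (nat \<Rightarrow> real ^ 'd::finite \<Rightarrow> real) \<Rightarrow> ('s \<Rightarrow> real ^ 'd \<Rightarrow> real ^ 'd) \<Rightarrow> real \<Rightarrow> real ^ 'd
     \<Rightarrow> (nat \<Rightarrow> bool \<times> (nat \<Rightarrow> 's)) \<Rightarrow> nat \<Rightarrow> (real ^ 'd) \<times> (real ^ 'd)" where
  "marina_path n fi Q \<gamma> x0 \<rho> = rec_nat (x0, grad (average_fun n fi) x0) (\<lambda>k st. marina_step n fi Q \<gamma> st (\<rho> k))"

lemma marina_path_simps [simp]:
  "marina_path n fi Q \<gamma> x0 \<rho> 0 = (x0, grad (average_fun n fi) x0)"
  "marina_path n fi Q \<gamma> x0 \<rho> (Suc k) = marina_step n fi Q \<gamma> (marina_path n fi Q \<gamma> x0 \<rho> k) (\<rho> k)"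
  by (simp_all add: marina_path_def)

text \<open>Points of a product measure space are extensional, hence the restriction to
  \<open>{1..n}\<close>; it is harmless because a round reads only the seeds of the workers
  \<open>1..n\<close>.\<close>

lemma marina_eq_path:
  "marina n fi Q \<gamma> x0 c s k = marina_path n fi Q \<gamma> x0 (\<lambda>k. (c k, \<lambda>i\<in>{1..n}. s k i)) k"
proof (induction k)
  case (Suc k)
  obtain x g where st: "marina n fi Q \<gamma> x0 c s k = (x, g)" by fastforce
  then have path: "marina_path n fi Q \<gamma> x0 (\<lambda>k. (c k, \<lambda>i\<in>{1..n}. s k i)) k = (x, g)"
    unfolding Suc.IH .
  show ?case
    unfolding marina.simps marina_path_simps st path marina_step_def Let_def prod.case
    by (auto intro!: arg_cong[where f = "scaleR _"] sum.cong)
qed simp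

lemma marina_sent_eq_path:
  assumes "i \<in> {1..n}"
  shows "real (marina_sent n fi Q \<gamma> x0 c s i K) = real (nnz (grad (fi i) x0)) +
    (\<Sum>k<K. marina_step_cost fi Q \<gamma> i (marina_path n fi Q \<gamma> x0 (\<lambda>k. (c k, \<lambda>i\<in>{1..n}. s k i)) k)
       (c k, \<lambda>i\<in>{1..n}. s k i))"
proof -
  have "real (let x = marina_x n fi Q \<gamma> x0 c s k; x' = marina_x n fi Q \<gamma> x0 c s (Suc k)
             in if c k then nnz (grad (fi i) x')
                else nnz (Q (s k i) (grad (fi i) x' - grad (fi i) x)))
    = marina_step_cost fi Q \<gamma> i (marina n fi Q \<gamma> x0 c s k) (c k, \<lambda>i\<in>{1..n}. s k i)" for k
    using assms by (auto simp: marina_x_def marina_step_cost_def Let_def split: prod.split)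
  then show ?thesis by (simp add: marina_sent_def marina_eq_path)
qed

lemma marina_path_cong:
  "(\<And>j. j < k \<Longrightarrow> \<rho> j = \<rho>' j) \<Longrightarrow> marina_path n fi Q \<gamma> x0 \<rho> k = marina_path n fi Q \<gamma> x0 \<rho>' k"
  by (induction k) auto

locale marina_problem =
  fixes n :: nat and fi :: "nat \<Rightarrow> real ^ 'd::finite \<Rightarrow> real" and Li :: "nat \<Rightarrow> real" and L :: real
    and S :: "'s measure" and Q :: "'s \<Rightarrow> real ^ 'd \<Rightarrow> real ^ 'd" and \<omega> p \<gamma> \<mu> :: real
    and x0 xstar :: "real ^ 'd"
  assumes n: "1 \<le> n"
    and smooth: "\<And>i. i \<in> {1..n} \<Longrightarrow> smooth_with (Li i) (fi i)"
    and L_nonneg: "0 \<le> L" and L_sq: "L\<^sup>2 = (\<Sum>i=1..n. (Li i)\<^sup>2) / real n"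
    and PL: "polyak_lojasiewicz \<mu> (average_fun n fi) xstar"
    and Q: "quantization_operator S Q \<omega>"
    and p: "0 < p" "p \<le> 1"
    and \<gamma>: "0 < \<gamma>"
      "\<gamma> \<le> min (1 / (L * (1 + sqrt (2 * ((1 - p) * \<omega> / (p * real n)))))) (p / (2 * \<mu>))"
begin

abbreviation f :: "real ^ 'd \<Rightarrow> real" where "f \<equiv> average_fun n fi"

abbreviation state :: "((real ^ 'd) \<times> (real ^ 'd)) measure" where "state \<equiv> borel \<Otimes>\<^sub>M borel"

abbreviation round :: "(bool \<times> (nat \<Rightarrow> 's)) measure" where
  "round \<equiv> measure_pmf (bernoulli_pmf p) \<Otimes>\<^sub>M (\<Pi>\<^sub>M i\<in>{1..n}. S)"

abbreviation path :: "(nat \<Rightarrow> bool \<times> (nat \<Rightarrow> 's)) \<Rightarrow> nat \<Rightarrow> (real ^ 'd) \<times> (real ^ 'd)" where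
  "path \<equiv> marina_path n fi Q \<gamma> x0"

definition lyapunov :: "(real ^ 'd) \<times> (real ^ 'd) \<Rightarrow> real" where
  "lyapunov = (\<lambda>(x, g). f x - f xstar + \<gamma> / p * (norm (g - grad f x))\<^sup>2)"

lemma prob_space_S: "prob_space S"
  using Q by (simp add: quantization_operator_def)

sublocale S: prob_space S by (rule prob_space_S)

sublocale seeds: prob_space "\<Pi>\<^sub>M i\<in>{1..n}. S"
  by (intro prob_space_PiM prob_space_S)

sublocale bernoulli_seeds: pair_prob_space "measure_pmf (bernoulli_pmf p)" "\<Pi>\<^sub>M i\<in>{1..n}. S"
  by unfold_locales

lemma prob_space_round: "prob_space round"
  by unfold_locales

lemma \<mu>_pos: "0 < \<mu>" and \<omega>_pos: "0 < \<omega>"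
  using PL Q by (simp_all add: polyak_lojasiewicz_def quantization_operator_def)

lemma fstar_le: "f xstar \<le> f x"
  using PL by (auto simp: polyak_lojasiewicz_def is_arg_min_linorder)

lemma PL_ineq: "2 * \<mu> * (f x - f xstar) \<le> (norm (grad f x))\<^sup>2"
  using PL by (simp add: polyak_lojasiewicz_def)

lemma grad_f: "grad f x = (1 / real n) *\<^sub>R (\<Sum>i=1..n. grad (fi i) x)"
  using smooth by (intro grad_average_fun) (simp add: smooth_with_def)

lemma f_smooth: "smooth_with L f"
  by (rule smooth_with_average_fun[OF n smooth L_nonneg L_sq])

text \<open>Division by zero yields 0, so \<open>L = 0\<close> would turn the stepsize bound into
  \<open>\<gamma> \<le> 0\<close>.\<close>

lemma L_pos: "0 < L"
  using \<gamma> L_nonneg by (cases "L = 0") auto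

lemma \<gamma>\<mu>_le: "\<gamma> * \<mu> \<le> p / 2"
proof -
  have "\<gamma> * \<mu> \<le> p / (2 * \<mu>) * \<mu>" using \<gamma> \<mu>_pos by (intro mult_right_mono) auto
  then show ?thesis using \<mu>_pos by simp
qed

lemma stepsize_bound: "2 * ((1 - p) * \<omega> / (p * real n)) * (\<gamma> * L)\<^sup>2 + \<gamma> * L \<le> 1"
  using \<gamma> L_pos p \<omega>_pos by (intro marina_stepsize_bound) auto

section \<open>Measurability of the dynamics and of its costs\<close>

lemma borel_measurable_f [measurable]: "f \<in> borel_measurable borel"
  using f_smooth by (intro borel_measurable_continuous_onI smooth_with_continuous_on)

lemma borel_measurable_grad_f [measurable]: "grad f \<in> borel_measurable borel"
  using f_smooth by (intro borel_measurable_continuous_onI smooth_with_continuous_on_grad)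

lemma borel_measurable_grad_fi [measurable]: "i \<in> {1..n} \<Longrightarrow> grad (fi i) \<in> borel_measurable borel"
  using smooth by (intro borel_measurable_continuous_onI smooth_with_continuous_on_grad)

lemma Q_measurable_pair: "(\<lambda>(s, x). Q s x) \<in> borel_measurable (S \<Otimes>\<^sub>M borel)"
  using Q by (simp add: quantization_operator_def)

text \<open>The vector given to \<open>Q\<close> depends on earlier rounds and is itself random, so
  measurability in the seed alone would not do.\<close>

lemma borel_measurable_Q [measurable (raw)]:
  assumes "s \<in> measurable N S" "y \<in> borel_measurable N"
  shows "(\<lambda>w. Q (s w) (y w)) \<in> borel_measurable N"
  using measurable_compose[OF measurable_Pair[OF assms] Q_measurable_pair] by simp

lemma Q_measurable: "(\<lambda>s. Q s y) \<in> borel_measurable S"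
  by measurable

lemma borel_measurable_lyapunov [measurable]: "lyapunov \<in> borel_measurable state"
  unfolding lyapunov_def by measurable

lemma measurable_marina_step [measurable]:
  "(\<lambda>(st, z). marina_step n fi Q \<gamma> st z) \<in> measurable (state \<Otimes>\<^sub>M round) state"
proof -
  have [measurable]: "(\<lambda>u. if fst (snd u) then grad (fi i) (fst (fst u) - \<gamma> *\<^sub>R snd (fst u))
       else snd (fst u) + Q (snd (snd u) i) (grad (fi i) (fst (fst u) - \<gamma> *\<^sub>R snd (fst u)) - grad (fi i) (fst (fst u))))
     \<in> borel_measurable (state \<Otimes>\<^sub>M round)" if [measurable]: "i \<in> {1..n}" for i
    by measurable
  show ?thesis
    unfolding marina_step_def Let_def case_prod_beta by measurable
qed

lemma measurable_marina_step_state [measurable]: "marina_step n fi Q \<gamma> st \<in> measurable round state"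
  using measurable_compose[OF measurable_Pair1' measurable_marina_step, of st]
  by (simp add: space_pair_measure)

lemma measurable_marina_step_cost [measurable]:
  assumes [measurable]: "i \<in> {1..n}"
  shows "(\<lambda>(st, z). marina_step_cost fi Q \<gamma> i st z) \<in> borel_measurable (state \<Otimes>\<^sub>M round)"
  unfolding marina_step_cost_def Let_def case_prod_beta if_distrib[of real] by measurable

section \<open>Integration over a single round\<close>

lemma nn_integral_round:
  assumes [measurable]: "h \<in> borel_measurable round"
  shows "(\<integral>\<^sup>+ z. h z \<partial>round) = ennreal p * (\<integral>\<^sup>+ s. h (True, s) \<partial>(\<Pi>\<^sub>M i\<in>{1..n}. S))
    + ennreal (1 - p) * (\<integral>\<^sup>+ s. h (False, s) \<partial>(\<Pi>\<^sub>M i\<in>{1..n}. S))"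
  using p assms by (subst seeds.nn_integral_fst[symmetric]) (simp_all add: mult.commute)

lemma integral_round:
  fixes h :: "bool \<times> (nat \<Rightarrow> 's) \<Rightarrow> real"
  assumes "h \<in> borel_measurable round" "\<And>z. \<bar>h z\<bar> \<le> C"
  shows "(\<integral>z. h z \<partial>round) = p * (\<integral>s. h (True, s) \<partial>(\<Pi>\<^sub>M i\<in>{1..n}. S))
    + (1 - p) * (\<integral>s. h (False, s) \<partial>(\<Pi>\<^sub>M i\<in>{1..n}. S))"
proof -
  have "integrable round h"
    using assms by (intro bernoulli_seeds.integrable_const_bound[where B = C]) auto
  then show ?thesis
    using p by (subst bernoulli_seeds.integral_fst'[symmetric]) (simp_all add: mult.commute)
qed

lemma integral_seed:
  fixes h :: "'s \<Rightarrow> real"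
  assumes "i \<in> {1..n}" and [measurable]: "h \<in> borel_measurable S"
  shows "(\<integral>s. h (s i) \<partial>(\<Pi>\<^sub>M i\<in>{1..n}. S)) = (\<integral>s. h s \<partial>S)"
proof -
  have "(\<integral>s. h s \<partial>distr (\<Pi>\<^sub>M i\<in>{1..n}. S) S (\<lambda>s. s i)) = (\<integral>s. h (s i) \<partial>(\<Pi>\<^sub>M i\<in>{1..n}. S))"
    using assms by (intro integral_distr) auto
  then show ?thesis
    using distr_PiM_component[of "{1..n}" "\<lambda>_. S" i] prob_space_S assms(1) by simp
qed

text \<open>Averaging scales each variance by \<open>1 / (real n)\<^sup>2\<close>, and independence
  adds only \<open>n\<close> of them: this is the gain of a factor \<open>n\<close> over a single
  worker.\<close>

lemma quantized_error_bound:
  "(\<integral>\<^sup>+ s. ennreal ((norm (a + (\<Sum>i=1..n. (1 / real n) *\<^sub>R (Q (s i) (y i) - y i))))\<^sup>2) \<partial>(\<Pi>\<^sub>M i\<in>{1..n}. S))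
    \<le> ennreal ((norm a)\<^sup>2 + (\<Sum>i=1..n. \<omega> * (norm (y i))\<^sup>2 / (real n)\<^sup>2))"
proof (rule nn_integral_norm_add_independent_sum_le)
  have sq: "(norm ((1 / real n) *\<^sub>R (Q s (y i) - y i)))\<^sup>2 = (norm (Q s (y i) - y i))\<^sup>2 / (real n)\<^sup>2" for s i
    by (simp add: power_divide)
  show "integrable S (\<lambda>s. (1 / real n) *\<^sub>R (Q s (y i) - y i))" for i
    using Q by (simp add: quantization_operator_def)
  show "(\<integral>s. (1 / real n) *\<^sub>R (Q s (y i) - y i) \<partial>S) = 0" for i
    using Q by (simp add: quantization_operator_def S.prob_space)
  show "integrable S (\<lambda>s. (norm ((1 / real n) *\<^sub>R (Q s (y i) - y i)))\<^sup>2)" for i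
    using Q unfolding sq by (simp add: quantization_operator_def)
  show "(\<integral>s. (norm ((1 / real n) *\<^sub>R (Q s (y i) - y i)))\<^sup>2 \<partial>S) \<le> \<omega> * (norm (y i))\<^sup>2 / (real n)\<^sup>2" for i
    using Q unfolding sq by (simp add: quantization_operator_def divide_right_mono)
qed (auto intro: prob_space_S)

lemma estimator_error_bound:
  fixes x g :: "real ^ 'd"
  defines "x' \<equiv> x - \<gamma> *\<^sub>R g"
  shows "(\<integral>\<^sup>+ z. ennreal ((norm (snd (marina_step n fi Q \<gamma> (x, g) z) - grad f x'))\<^sup>2) \<partial>round)
    \<le> ennreal ((1 - p) * ((norm (g - grad f x))\<^sup>2 + \<omega> * (L * \<gamma> * norm g)\<^sup>2 / real n))"
proof -
  define y where "y i = grad (fi i) x' - grad (fi i) x" for i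
  have synced: "snd (marina_step n fi Q \<gamma> (x, g) (True, s)) = grad f x'" for s
    by (simp add: marina_step_def x'_def grad_f Let_def)
  have "grad f x' - grad f x = (1 / real n) *\<^sub>R (\<Sum>i=1..n. y i)"
    by (simp add: grad_f y_def sum_subtractf scaleR_diff_right)
  \<comment> \<open>The exact increment of \<open>grad f\<close> is the mean of the
    \<open>y i\<close>; subtracting it leaves the old error plus noise that is centred because
    \<open>Q\<close> is unbiased.\<close>
  then have quantized: "snd (marina_step n fi Q \<gamma> (x, g) (False, s)) - grad f x'
      = (g - grad f x) + (\<Sum>i=1..n. (1 / real n) *\<^sub>R (Q (s i) (y i) - y i))" for s
    using n by (simp add: marina_step_def Let_def y_def[symmetric] x'_def[symmetric] sum.distrib
        sum_subtractf scaleR_right_distrib scaleR_diff_right sum_constant_scaleR algebra_simps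
        del: sum_constant flip: scaleR_sum_right)
  have "(\<Sum>i=1..n. (norm (y i))\<^sup>2) \<le> (\<Sum>i=1..n. (Li i)\<^sup>2 * (\<gamma> * norm g)\<^sup>2)"
  proof (rule sum_mono)
    fix i assume i: "i \<in> {1..n}"
    have "norm (y i) \<le> Li i * norm (x' - x)"
      using smooth[OF i] unfolding y_def smooth_with_def by blast
    also have "norm (x' - x) = \<gamma> * norm g" using \<gamma> by (simp add: x'_def)
    finally show "(norm (y i))\<^sup>2 \<le> (Li i)\<^sup>2 * (\<gamma> * norm g)\<^sup>2"
      by (metis norm_ge_zero power_mono power_mult_distrib)
  qed
  \<comment> \<open>The quadratic mean is the right \<open>L\<close> here: the squares of the
    \<open>Li\<close> sum to \<open>real n * L\<^sup>2\<close> without loss.\<close>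
  also have "\<dots> = real n * (L * \<gamma> * norm g)\<^sup>2"
    using n by (simp add: L_sq power_mult_distrib flip: sum_distrib_right)
  finally have "\<omega> / (real n)\<^sup>2 * (\<Sum>i=1..n. (norm (y i))\<^sup>2) \<le> \<omega> / (real n)\<^sup>2 * (real n * (L * \<gamma> * norm g)\<^sup>2)"
    using \<omega>_pos by (intro mult_left_mono) auto
  then have drift: "(\<Sum>i=1..n. \<omega> * (norm (y i))\<^sup>2 / (real n)\<^sup>2) \<le> \<omega> * (L * \<gamma> * norm g)\<^sup>2 / real n"
    using n by (simp add: sum_distrib_left power2_eq_square[of "real n"])
  have meas: "(\<lambda>z. ennreal ((norm (snd (marina_step n fi Q \<gamma> (x, g) z) - grad f x'))\<^sup>2)) \<in> borel_measurable round"
    by measurable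
  have "(\<integral>\<^sup>+ z. ennreal ((norm (snd (marina_step n fi Q \<gamma> (x, g) z) - grad f x'))\<^sup>2) \<partial>round)
      = ennreal (1 - p) * (\<integral>\<^sup>+ s. ennreal ((norm ((g - grad f x)
          + (\<Sum>i=1..n. (1 / real n) *\<^sub>R (Q (s i) (y i) - y i))))\<^sup>2) \<partial>(\<Pi>\<^sub>M i\<in>{1..n}. S))"
    by (subst nn_integral_round[OF meas]) (simp add: synced quantized)
  also have "\<dots> \<le> ennreal (1 - p) * ennreal ((norm (g - grad f x))\<^sup>2 + (\<Sum>i=1..n. \<omega> * (norm (y i))\<^sup>2 / (real n)\<^sup>2))"
    by (intro mult_left_mono quantized_error_bound) simp
  also have "\<dots> \<le> ennreal (1 - p) * ennreal ((norm (g - grad f x))\<^sup>2 + \<omega> * (L * \<gamma> * norm g)\<^sup>2 / real n)"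
    using drift by (intro mult_left_mono ennreal_leI) auto
  finally show ?thesis using p \<omega>_pos by (simp add: ennreal_mult)
qed

lemma lyapunov_contraction:
  "(\<integral>\<^sup>+ z. ennreal (lyapunov (marina_step n fi Q \<gamma> st z)) \<partial>round) \<le> ennreal ((1 - \<gamma> * \<mu>) * lyapunov st)"
proof -
  obtain x g where st: "st = (x, g)" by fastforce
  define x' where "x' = x - \<gamma> *\<^sub>R g"
  define e where "e = (norm (g - grad f x))\<^sup>2"
  define u where "u = (norm g)\<^sup>2"
  define a where "a = (1 - p) * \<omega> / (p * real n)"
  have nonneg: "0 \<le> e" "0 \<le> u" by (simp_all add: e_def u_def)
  \<comment> \<open>The next iterate is fixed by the state, so averaging over the round affects only
    the estimator error.\<close>
  have "fst (marina_step n fi Q \<gamma> (x, g) z) = x'" for z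
    by (cases z) (simp add: marina_step_def x'_def Let_def)
  then have "lyapunov (marina_step n fi Q \<gamma> (x, g) z)
      = (f x' - f xstar) + \<gamma> / p * (norm (snd (marina_step n fi Q \<gamma> (x, g) z) - grad f x'))\<^sup>2" for z
    by (simp add: lyapunov_def case_prod_beta)
  then have lyap: "ennreal (lyapunov (marina_step n fi Q \<gamma> st z)) = ennreal (f x' - f xstar)
      + ennreal (\<gamma> / p) * ennreal ((norm (snd (marina_step n fi Q \<gamma> (x, g) z) - grad f x'))\<^sup>2)" for z
    using fstar_le[of x'] \<gamma> p unfolding st
    by (subst ennreal_mult[symmetric]) (auto simp: ennreal_plus[symmetric] simp del: ennreal_plus)
  have meas: "(\<lambda>z. ennreal ((norm (snd (marina_step n fi Q \<gamma> (x, g) z) - grad f x'))\<^sup>2)) \<in> borel_measurable round"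
    by measurable
  from lyap have "(\<integral>\<^sup>+ z. ennreal (lyapunov (marina_step n fi Q \<gamma> st z)) \<partial>round)
      = ennreal (f x' - f xstar) + ennreal (\<gamma> / p) *
        (\<integral>\<^sup>+ z. ennreal ((norm (snd (marina_step n fi Q \<gamma> (x, g) z) - grad f x'))\<^sup>2) \<partial>round)"
    by (simp only: nn_integral_add nn_integral_cmult meas borel_measurable_times_ennreal borel_measurable_const
        nn_integral_const prob_space.emeasure_space_1[OF prob_space_round] mult_1_right)
  also have "\<dots> \<le> ennreal (f x' - f xstar) + ennreal (\<gamma> / p) *
        ennreal ((1 - p) * (e + \<omega> * (L * \<gamma> * norm g)\<^sup>2 / real n))"
    unfolding e_def x'_def by (intro add_left_mono mult_left_mono estimator_error_bound) simp
  also have "\<dots> = ennreal (f x' - f xstar + \<gamma> / p * ((1 - p) * (e + \<omega> * (L * \<gamma> * norm g)\<^sup>2 / real n)))"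
  proof -
    have "0 \<le> (1 - p) * (e + \<omega> * (L * \<gamma> * norm g)\<^sup>2 / real n)"
      using p \<omega>_pos nonneg by simp
    moreover have "0 \<le> \<gamma> / p" "0 \<le> f x' - f xstar" using p \<gamma> fstar_le[of x'] by simp_all
    ultimately show ?thesis
      by (simp only: ennreal_mult ennreal_plus mult_nonneg_nonneg)
  qed
  also have "\<dots> \<le> ennreal ((1 - \<gamma> * \<mu>) * lyapunov st)"
  proof (rule ennreal_leI)
    define q where "q = \<gamma> / p"
    define T where "T = q * ((1 - p) * (e + \<omega> * (L * \<gamma> * norm g)\<^sup>2 / real n))"
    have "f x' \<le> f x - \<gamma> / 2 * (norm (grad f x))\<^sup>2 - (\<gamma> / 2 - L * \<gamma>\<^sup>2 / 2) * u + \<gamma> / 2 * e"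
      unfolding x'_def e_def u_def by (rule smooth_with_inexact_gradient_step[OF f_smooth])
    moreover have "\<gamma> / 2 * (2 * \<mu> * (f x - f xstar)) \<le> \<gamma> / 2 * (norm (grad f x))\<^sup>2"
      using \<gamma> PL_ineq by (intro mult_left_mono) auto
    moreover have "T = (q - \<gamma>) * e + \<gamma> * a * (\<gamma> * L)\<^sup>2 * u"
      using p n by (simp add: T_def q_def a_def u_def power_mult_distrib field_simps)
    \<comment> \<open>The \<open>u\<close> terms of the descent bound and of \<open>T\<close> add up
      to at most 0. The 2 under the square root of the stepsize compensates for the factor
      \<open>\<gamma> / 2\<close> of the descent bound.\<close>
    moreover have "\<gamma> / 2 * u * (2 * a * (\<gamma> * L)\<^sup>2 + \<gamma> * L) \<le> \<gamma> / 2 * u * 1"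
      using stepsize_bound \<gamma> nonneg unfolding a_def by (intro mult_left_mono) auto
    \<comment> \<open>The error terms leave \<open>(q - \<gamma> / 2) * e\<close>, which this bounds
      by \<open>(1 - \<gamma> * \<mu>) * q * e\<close>.\<close>
    moreover have "q * e * (\<gamma> * \<mu>) \<le> \<gamma> / 2 * e"
    proof -
      have "q * e * (\<gamma> * \<mu>) \<le> q * e * (p / 2)"
        using \<gamma> p nonneg \<gamma>\<mu>_le unfolding q_def by (intro mult_left_mono) auto
      also have "\<dots> = \<gamma> / 2 * e" using p by (simp add: q_def)
      finally show ?thesis .
    qed
    moreover have lyap_st: "lyapunov st = f x - f xstar + q * e"
      by (simp add: st lyapunov_def e_def q_def)
    ultimately have "f x' - f xstar + T \<le> (1 - \<gamma> * \<mu>) * lyapunov st"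
      unfolding lyap_st by (simp add: algebra_simps power2_eq_square[of \<gamma>])
    then show "f x' - f xstar + \<gamma> / p * ((1 - p) * (e + \<omega> * (L * \<gamma> * norm g)\<^sup>2 / real n))
        \<le> (1 - \<gamma> * \<mu>) * lyapunov st"
      by (simp only: T_def q_def)
  qed
  finally show ?thesis .
qed

end

section \<open>Runs of MARINA\<close>

locale marina_run = marina_problem n fi Li L S Q \<omega> p \<gamma> \<mu> x0 xstar
  for n and fi :: "nat \<Rightarrow> real ^ 'd::finite \<Rightarrow> real" and Li L and S :: "'s measure" and Q \<omega> p \<gamma> \<mu> x0 xstar +
  fixes M :: "'a measure" and c :: "'a \<Rightarrow> nat \<Rightarrow> bool" and \<xi> :: "'a \<Rightarrow> nat \<Rightarrow> nat \<Rightarrow> 's"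
  assumes randomness: "marina_randomness M S p n c \<xi>"
begin

abbreviation rounds :: "(nat \<Rightarrow> bool \<times> (nat \<Rightarrow> 's)) measure" where
  "rounds \<equiv> \<Pi>\<^sub>M k\<in>UNIV. round"

definition draws :: "'a \<Rightarrow> nat \<Rightarrow> bool \<times> (nat \<Rightarrow> 's)" where
  "draws w k = (c w k, \<lambda>i\<in>{1..n}. \<xi> w k i)"

definition iter :: "nat \<Rightarrow> 'a \<Rightarrow> (real ^ 'd) \<times> (real ^ 'd)" where
  "iter k w = path (draws w) k"

sublocale M: prob_space M
  using randomness by (simp add: marina_randomness_def)

lemma measurable_draws [measurable]: "draws \<in> measurable M rounds"
  using randomness
  unfolding marina_randomness_def marina_sample_space_def draws_def[abs_def] by simp

lemma distr_draws: "distr M rounds draws = rounds"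
  using randomness
  unfolding marina_randomness_def marina_sample_space_def draws_def[abs_def] by simp

lemma measurable_draws_component [measurable]: "(\<lambda>w. draws w k) \<in> measurable M round"
  by (rule measurable_compose[OF measurable_draws measurable_component_singleton]) simp

lemma measurable_path [measurable]: "(\<lambda>\<rho>. path \<rho> k) \<in> measurable rounds state"
proof (induction k)
  case (Suc k)
  have "(\<lambda>\<rho>. \<rho> k) \<in> measurable rounds round"
    by (rule measurable_component_singleton) simp
  from measurable_compose[OF measurable_Pair[OF Suc this] measurable_marina_step]
  show ?case by simp
qed simp

lemma measurable_iter [measurable]: "iter k \<in> measurable M state"
  unfolding iter_def[abs_def] by (rule measurable_compose[OF measurable_draws measurable_path])

lemma iter_0: "iter 0 w = (x0, grad f x0)"
  and iter_Suc: "iter (Suc k) w = marina_step n fi Q \<gamma> (iter k w) (draws w k)"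
  by (simp_all add: iter_def)

text \<open>
  \<open>path \<rho> k\<close> only looks at the first \<open>k\<close> rounds, so replacing all later ones by an independent
  copy of the sequence, which changes neither law, makes it independent of round \<open>k\<close>.
\<close>

lemma distr_path_round:
  "distr rounds (state \<Otimes>\<^sub>M round) (\<lambda>\<rho>. (path \<rho> k, \<rho> k)) = distr rounds state (\<lambda>\<rho>. path \<rho> k) \<Otimes>\<^sub>M round"
proof -
  interpret product_prob_space "\<lambda>_::nat. round" UNIV
    by (intro product_prob_spaceI prob_space_round)
  interpret sequence_space round ..
  interpret rounds: prob_space rounds by (intro prob_space_PiM prob_space_round)
  have comp [measurable]: "(\<lambda>\<rho>. \<rho> j) \<in> measurable rounds round" for j
    by (rule measurable_component_singleton) simp
  have round: "distr rounds round (\<lambda>\<rho>. \<rho> 0) = round"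
    by (rule PiM_component) simp
  have "distr rounds (state \<Otimes>\<^sub>M round) (\<lambda>\<rho>. (path \<rho> k, \<rho> k))
      = distr (distr (rounds \<Otimes>\<^sub>M rounds) rounds (\<lambda>(\<rho>, \<rho>'). comb_seq k \<rho> \<rho>')) (state \<Otimes>\<^sub>M round) (\<lambda>\<rho>. (path \<rho> k, \<rho> k))"
    by (simp only: PiM_comb_seq)
  also have "\<dots> = distr (rounds \<Otimes>\<^sub>M rounds) (state \<Otimes>\<^sub>M round)
      ((\<lambda>\<rho>. (path \<rho> k, \<rho> k)) \<circ> (\<lambda>(\<rho>, \<rho>'). comb_seq k \<rho> \<rho>'))"
    by (intro distr_distr measurable_comb_seq measurable_Pair measurable_path comp)
  \<comment> \<open>\<open>comb_seq k\<close> shifts its second sequence by \<open>k\<close>, so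
    entry \<open>k\<close> is \<open>\<rho>' 0\<close> and all earlier entries come from
    \<open>\<rho>\<close>.\<close>
  also have "(\<lambda>\<rho>. (path \<rho> k, \<rho> k)) \<circ> (\<lambda>(\<rho>, \<rho>'). comb_seq k \<rho> \<rho>') = (\<lambda>(\<rho>, \<rho>'). (path \<rho> k, \<rho>' 0))"
    by (auto simp: fun_eq_iff comb_seq_def intro!: marina_path_cong)
  also have "distr (rounds \<Otimes>\<^sub>M rounds) (state \<Otimes>\<^sub>M round) \<dots>
      = distr rounds state (\<lambda>\<rho>. path \<rho> k) \<Otimes>\<^sub>M distr rounds round (\<lambda>\<rho>. \<rho> 0)"
    by (intro pair_measure_distr[symmetric] measurable_path comp) (simp only: round prob_space_imp_sigma_finite prob_space_round)
  finally show ?thesis by (simp only: round)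
qed

text \<open>Only the law of the draws on \<open>M\<close> is known. State and round are both
  functions of the draws, so the identity carries over from \<open>rounds\<close>.\<close>

lemma distr_iter_draws:
  "distr M (state \<Otimes>\<^sub>M round) (\<lambda>w. (iter k w, draws w k)) = distr M state (iter k) \<Otimes>\<^sub>M round"
proof -
  have comp: "(\<lambda>\<rho>. \<rho> k) \<in> measurable rounds round"
    by (rule measurable_component_singleton) simp
  have "distr M (state \<Otimes>\<^sub>M round) (\<lambda>w. (iter k w, draws w k))
      = distr (distr M rounds draws) (state \<Otimes>\<^sub>M round) (\<lambda>\<rho>. (path \<rho> k, \<rho> k))"
    by (subst distr_distr) (auto simp only: comp_def iter_def measurable_draws intro!: measurable_Pair measurable_path comp)
  also have "\<dots> = distr rounds state (\<lambda>\<rho>. path \<rho> k) \<Otimes>\<^sub>M round"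
    by (simp only: distr_draws distr_path_round)
  also have "distr rounds state (\<lambda>\<rho>. path \<rho> k) = distr (distr M rounds draws) state (\<lambda>\<rho>. path \<rho> k)"
    by (simp only: distr_draws)
  also have "\<dots> = distr M state (iter k)"
    by (subst distr_distr) (auto simp only: comp_def iter_def[abs_def] measurable_draws measurable_path)
  finally show ?thesis .
qed

lemma nn_integral_iter_draws:
  assumes [measurable]: "h \<in> borel_measurable (state \<Otimes>\<^sub>M round)"
  shows "(\<integral>\<^sup>+ w. h (iter k w, draws w k) \<partial>M) = (\<integral>\<^sup>+ w. (\<integral>\<^sup>+ z. h (iter k w, z) \<partial>round) \<partial>M)"
proof -
  have h: "h \<in> borel_measurable (distr M state (iter k) \<Otimes>\<^sub>M round)"
    by measurable
  have "(\<integral>\<^sup>+ w. h (iter k w, draws w k) \<partial>M) = (\<integral>\<^sup>+ u. h u \<partial>distr M (state \<Otimes>\<^sub>M round) (\<lambda>w. (iter k w, draws w k)))"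
    by (rule nn_integral_distr[symmetric]) measurable
  also have "\<dots> = (\<integral>\<^sup>+ st. (\<integral>\<^sup>+ z. h (st, z) \<partial>round) \<partial>distr M state (iter k))"
    unfolding distr_iter_draws
    by (rule sigma_finite_measure.nn_integral_fst[OF prob_space_imp_sigma_finite[OF prob_space_round] h, symmetric])
  also have "\<dots> = (\<integral>\<^sup>+ w. (\<integral>\<^sup>+ z. h (iter k w, z) \<partial>round) \<partial>M)"
    by (rule nn_integral_distr, measurable)
  finally show ?thesis .
qed

text \<open>Counterpart for the costs, where exact expectations are wanted; the uniform bound
  supplies the integrability that Fubini requires.\<close>

lemma integral_iter_draws:
  fixes h :: "((real ^ 'd) \<times> (real ^ 'd)) \<times> (bool \<times> (nat \<Rightarrow> 's)) \<Rightarrow> real"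
  assumes [measurable]: "h \<in> borel_measurable (state \<Otimes>\<^sub>M round)" and bound: "\<And>u. \<bar>h u\<bar> \<le> C"
  shows "integrable M (\<lambda>w. h (iter k w, draws w k))"
    and "(\<integral>w. h (iter k w, draws w k) \<partial>M) = (\<integral>w. (\<integral>z. h (iter k w, z) \<partial>round) \<partial>M)"
proof -
  have sf: "sigma_finite_measure round"
    by (rule prob_space_imp_sigma_finite[OF prob_space_round])
  show "integrable M (\<lambda>w. h (iter k w, draws w k))"
    using bound by (intro M.integrable_const_bound[where B = C]) auto
  have pm: "(\<lambda>w. (iter k w, draws w k)) \<in> measurable M (state \<Otimes>\<^sub>M round)"
    by measurable
  have "prob_space (distr M (state \<Otimes>\<^sub>M round) (\<lambda>w. (iter k w, draws w k)))"
    by (rule M.prob_space_distr[OF pm])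
  then have ps: "prob_space (distr M state (iter k) \<Otimes>\<^sub>M round)"
    by (simp only: distr_iter_draws)
  have "(\<integral>w. h (iter k w, draws w k) \<partial>M) = (\<integral>u. h u \<partial>distr M (state \<Otimes>\<^sub>M round) (\<lambda>w. (iter k w, draws w k)))"
    by (rule integral_distr[symmetric]) measurable
  also have "\<dots> = (\<integral>st. (\<integral>z. h (st, z) \<partial>round) \<partial>distr M state (iter k))"
    unfolding distr_iter_draws
  proof (rule pair_sigma_finite.integral_fst'[symmetric])
    show "pair_sigma_finite (distr M state (iter k)) round"
      using sf M.prob_space_distr[OF measurable_iter] by (simp add: pair_sigma_finite_def prob_space_imp_sigma_finite)
    have "h \<in> borel_measurable (distr M state (iter k) \<Otimes>\<^sub>M round)"
      by measurable
    then show "integrable (distr M state (iter k) \<Otimes>\<^sub>M round) h"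
      using bound by (intro finite_measure.integrable_const_bound[where B = C] prob_space.finite_measure ps) auto
  qed
  also have "\<dots> = (\<integral>w. (\<integral>z. h (iter k w, z) \<partial>round) \<partial>M)"
    by (rule integral_distr, measurable)
  finally show "(\<integral>w. h (iter k w, draws w k) \<partial>M) = (\<integral>w. (\<integral>z. h (iter k w, z) \<partial>round) \<partial>M)" .
qed

section \<open>Convergence in expectation\<close>

lemma nn_integral_lyapunov_le:
  "(\<integral>\<^sup>+ w. ennreal (lyapunov (iter k w)) \<partial>M) \<le> ennreal ((1 - \<gamma> * \<mu>) ^ k * (f x0 - f xstar))"
proof (induction k)
  case 0
  \<comment> \<open>The initial estimator is exact, so the Lyapunov function starts at the plain
    suboptimality.\<close>
  show ?case by (simp add: iter_0 lyapunov_def M.emeasure_space_1)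
next
  case (Suc k)
  have le1: "0 \<le> 1 - \<gamma> * \<mu>" using \<gamma>\<mu>_le p by simp
  have "(\<lambda>u. ennreal (lyapunov (case u of (st, z) \<Rightarrow> marina_step n fi Q \<gamma> st z))) \<in> borel_measurable (state \<Otimes>\<^sub>M round)"
    by measurable
  from nn_integral_iter_draws[OF this, of k]
  have "(\<integral>\<^sup>+ w. ennreal (lyapunov (iter (Suc k) w)) \<partial>M)
      = (\<integral>\<^sup>+ w. (\<integral>\<^sup>+ z. ennreal (lyapunov (marina_step n fi Q \<gamma> (iter k w) z)) \<partial>round) \<partial>M)"
    by (simp only: iter_Suc prod.case)
  also have "\<dots> \<le> (\<integral>\<^sup>+ w. ennreal (1 - \<gamma> * \<mu>) * ennreal (lyapunov (iter k w)) \<partial>M)"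
    using le1 by (intro nn_integral_mono order_trans[OF lyapunov_contraction]) (simp add: ennreal_mult')
  also have "\<dots> = ennreal (1 - \<gamma> * \<mu>) * (\<integral>\<^sup>+ w. ennreal (lyapunov (iter k w)) \<partial>M)"
    by (rule nn_integral_cmult) measurable
  also have "\<dots> \<le> ennreal (1 - \<gamma> * \<mu>) * ennreal ((1 - \<gamma> * \<mu>) ^ k * (f x0 - f xstar))"
    by (intro mult_left_mono Suc) simp
  also have "\<dots> = ennreal ((1 - \<gamma> * \<mu>) ^ Suc k * (f x0 - f xstar))"
    using le1 by (simp add: ennreal_mult'[symmetric] mult.assoc)
  finally show ?case .
qed

lemma expected_suboptimality:
  shows "integrable M (\<lambda>w. f (fst (iter k w)) - f xstar)"
    and "(\<integral>w. f (fst (iter k w)) - f xstar \<partial>M) \<le> (1 - \<gamma> * \<mu>) ^ k * (f x0 - f xstar)"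
proof -
  have [measurable]: "(\<lambda>w. f (fst (iter k w)) - f xstar) \<in> borel_measurable M" by measurable
  have "f (fst st) - f xstar \<le> lyapunov st" for st
    using \<gamma> p by (cases st) (simp add: lyapunov_def)
  then have "(\<integral>\<^sup>+ w. ennreal (f (fst (iter k w)) - f xstar) \<partial>M) \<le> (\<integral>\<^sup>+ w. ennreal (lyapunov (iter k w)) \<partial>M)"
    by (intro nn_integral_mono ennreal_leI)
  also note nn_integral_lyapunov_le
  finally have bound: "(\<integral>\<^sup>+ w. ennreal (f (fst (iter k w)) - f xstar) \<partial>M) \<le> ennreal ((1 - \<gamma> * \<mu>) ^ k * (f x0 - f xstar))" .
  show int: "integrable M (\<lambda>w. f (fst (iter k w)) - f xstar)"
    by (rule integrableI_nonneg) (use fstar_le bound in \<open>auto intro: order.strict_trans1\<close>)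
  have "0 \<le> (1 - \<gamma> * \<mu>) ^ k * (f x0 - f xstar)" using \<gamma>\<mu>_le p fstar_le by simp
  then show "(\<integral>w. f (fst (iter k w)) - f xstar \<partial>M) \<le> (1 - \<gamma> * \<mu>) ^ k * (f x0 - f xstar)"
    using bound fstar_le by (simp add: nn_integral_eq_integral[OF int])
qed

section \<open>Communication cost in expectation\<close>

lemma expected_coin_value:
  fixes A B :: real
  shows "integrable M (\<lambda>w. if c w k then A else B)"
    and "(\<integral>w. (if c w k then A else B) \<partial>M) = p * A + (1 - p) * B"
proof -
  \<comment> \<open>The coin is read as a function of state and round that ignores the state; the
    Fubini identity then replaces a computation of its marginal law.\<close>
  define h :: "((real ^ 'd) \<times> (real ^ 'd)) \<times> (bool \<times> (nat \<Rightarrow> 's)) \<Rightarrow> real"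
    where "h u = (if fst (snd u) then A else B)" for u
  have h: "h \<in> borel_measurable (state \<Otimes>\<^sub>M round)" unfolding h_def by measurable
  have bound: "\<bar>h u\<bar> \<le> \<bar>A\<bar> + \<bar>B\<bar>" for u by (simp add: h_def)
  have hc: "h (iter k w, draws w k) = (if c w k then A else B)" for w
    by (simp add: h_def draws_def)
  have "(\<integral>z. h (st, z) \<partial>round) = p * A + (1 - p) * B" for st
  proof -
    have "(\<lambda>z. h (st, z)) \<in> borel_measurable round"
      using measurable_compose[OF measurable_Pair1' h, of st] by (simp add: space_pair_measure)
    from integral_round[OF this bound] show ?thesis
      using seeds.prob_space by (simp add: h_def)
  qed
  with integral_iter_draws[OF h bound, of k]
  show "integrable M (\<lambda>w. if c w k then A else B)"
    and "(\<integral>w. (if c w k then A else B) \<partial>M) = p * A + (1 - p) * B"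
    by (simp_all add: hc M.prob_space)
qed

lemma expected_step_cost:
  assumes i: "i \<in> {1..n}"
  shows "integrable M (\<lambda>w. marina_step_cost fi Q \<gamma> i (iter k w) (draws w k))"
    and "(\<integral>w. marina_step_cost fi Q \<gamma> i (iter k w) (draws w k) \<partial>M)
      = (\<integral>w. p * real (nnz (grad (fi i) (fst (iter (Suc k) w))))
          + (1 - p) * (\<integral>s. real (nnz (Q s (grad (fi i) (fst (iter (Suc k) w)) - grad (fi i) (fst (iter k w))))) \<partial>S) \<partial>M)"
proof -
  note [measurable] = i
  define h where "h = (\<lambda>(st, z). marina_step_cost fi Q \<gamma> i st z)"
  have h: "h \<in> borel_measurable (state \<Otimes>\<^sub>M round)" unfolding h_def by measurable
  have bound: "\<bar>h u\<bar> \<le> real CARD('d)" for u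
    by (simp add: h_def marina_step_cost_def Let_def case_prod_beta nnz_le_CARD)
  have "(\<integral>z. h (iter k w, z) \<partial>round) = p * real (nnz (grad (fi i) (fst (iter (Suc k) w))))
          + (1 - p) * (\<integral>s. real (nnz (Q s (grad (fi i) (fst (iter (Suc k) w)) - grad (fi i) (fst (iter k w))))) \<partial>S)" for w
  proof -
    obtain x g where st: "iter k w = (x, g)" by fastforce
    \<comment> \<open>Although written with \<open>iter (Suc k)\<close>, the right-hand side depends
      on the state before round \<open>k\<close> alone, as a conditional expectation given that
      state must.\<close>
    have x': "fst (iter (Suc k) w) = x - \<gamma> *\<^sub>R g"
      by (cases "draws w k") (simp add: iter_Suc st marina_step_def Let_def)
    have "(\<lambda>z. h (iter k w, z)) \<in> borel_measurable round"
      using measurable_compose[OF measurable_Pair1' h, of "iter k w"] by (simp add: space_pair_measure)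
    from integral_round[OF this bound]
    have "(\<integral>z. h (iter k w, z) \<partial>round) = p * (\<integral>s. h (iter k w, True, s) \<partial>(\<Pi>\<^sub>M i\<in>{1..n}. S))
        + (1 - p) * (\<integral>s. h (iter k w, False, s) \<partial>(\<Pi>\<^sub>M i\<in>{1..n}. S))" .
    moreover have "(\<integral>s. h (iter k w, True, s) \<partial>(\<Pi>\<^sub>M i\<in>{1..n}. S)) = real (nnz (grad (fi i) (x - \<gamma> *\<^sub>R g)))"
      using seeds.prob_space by (simp add: h_def st marina_step_cost_def Let_def)
    moreover have "(\<integral>s. h (iter k w, False, s) \<partial>(\<Pi>\<^sub>M i\<in>{1..n}. S))
        = (\<integral>s. real (nnz (Q s (grad (fi i) (x - \<gamma> *\<^sub>R g) - grad (fi i) x))) \<partial>S)"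
    proof -
      have "(\<lambda>s. real (nnz (Q s (grad (fi i) (x - \<gamma> *\<^sub>R g) - grad (fi i) x)))) \<in> borel_measurable S"
        by measurable
      from integral_seed[OF i this] show ?thesis by (simp add: h_def st marina_step_cost_def Let_def)
    qed
    ultimately show ?thesis unfolding x' by (simp add: st)
  qed
  with integral_iter_draws[OF h bound, of k]
  show "integrable M (\<lambda>w. marina_step_cost fi Q \<gamma> i (iter k w) (draws w k))"
    and "(\<integral>w. marina_step_cost fi Q \<gamma> i (iter k w) (draws w k) \<partial>M)
      = (\<integral>w. p * real (nnz (grad (fi i) (fst (iter (Suc k) w))))
          + (1 - p) * (\<integral>s. real (nnz (Q s (grad (fi i) (fst (iter (Suc k) w)) - grad (fi i) (fst (iter k w))))) \<partial>S) \<partial>M)"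
    by (simp_all add: h_def)
qed

end

text \<open>The cost formula is exact for the nominal price; actual transmissions can be sparser, so
  for them it is an upper bound, with equality under full density. The range
  \<open>\<epsilon> \<le> \<Delta>0 / 2\<close> keeps the logarithm away from 0: the rate needs at
  least one iteration as soon as \<open>\<epsilon> < \<Delta>0\<close>, while the logarithm vanishes
  as \<open>\<epsilon>\<close> approaches \<open>\<Delta>0\<close>.\<close>

theorem theoremC2:
  fixes fi :: "nat \<Rightarrow> real ^ 'd::finite \<Rightarrow> real"
    and f :: "real ^ 'd \<Rightarrow> real"
    and x0 xstar :: "real ^ 'd"
    and Li :: "nat \<Rightarrow> real"
    and f_low L \<mu> \<omega> p \<gamma> \<Delta>0 \<kappa> \<zeta> d :: real
    and n :: nat
    and S :: "'s measure"
    and Q :: "'s \<Rightarrow> real ^ 'd \<Rightarrow> real ^ 'd"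
    and M :: "'a measure"
    and c :: "'a \<Rightarrow> nat \<Rightarrow> bool"
    and \<xi> :: "'a \<Rightarrow> nat \<Rightarrow> nat \<Rightarrow> 's"
    and x :: "nat \<Rightarrow> 'a \<Rightarrow> real ^ 'd"
    and sent :: "nat \<Rightarrow> nat \<Rightarrow> 'a \<Rightarrow> real"
  assumes "1 \<le> n"
    and "f = average_fun n fi"
    and "\<And>y. f_low \<le> f y"
    and "\<And>i. i \<in> {1..n} \<Longrightarrow> smooth_with (Li i) (fi i)"
    and "0 \<le> L" and "L\<^sup>2 = (\<Sum>i=1..n. (Li i)\<^sup>2) / real n"
    and "polyak_lojasiewicz \<mu> f xstar"
    and "quantization_operator S Q \<omega>"
    and "0 < p" and "p \<le> 1"
    and "0 < \<gamma>"
    and "\<gamma> \<le> min (1 / (L * (1 + sqrt (2 * (1 - p) * \<omega> / (p * real n))))) (p / (2 * \<mu>))"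
    and "marina_randomness M S p n c \<xi>"
    and "\<And>k w. x k w = marina_x n fi Q \<gamma> x0 (c w) (\<xi> w) k"
    and "\<And>i K w. sent i K w = real (marina_sent n fi Q \<gamma> x0 (c w) (\<xi> w) i K)"
    and "\<Delta>0 = f x0 - f xstar"
    and "\<kappa> = max (1 / p) (L / \<mu> * (1 + sqrt ((1 - p) * \<omega> / (p * real n))))"
    and "\<zeta> = expected_density S Q"
    and "d = real CARD('d)"
  shows
    "(\<forall>K. integrable M (\<lambda>w. f (x K w) - f xstar) \<and>
          (\<integral>w. f (x K w) - f xstar \<partial>M) \<le> (1 - \<gamma> * \<mu>) ^ K * \<Delta>0)
     \<and>
     (\<forall>K. integrable M (\<lambda>w. marina_nominal_cost S Q (c w) K) \<and>
          (\<integral>w. marina_nominal_cost S Q (c w) K \<partial>M) = d + real K * (p * d + (1 - p) * \<zeta>))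
     \<and>
     (\<forall>K. \<forall>i\<in>{1..n}.
          integrable M (sent i K) \<and>
          (\<integral>w. sent i K w \<partial>M) \<le> d + real K * (p * d + (1 - p) * \<zeta>) \<and>
          (real (nnz (grad (fi i) x0)) = d \<and>
           (\<forall>k<K. AE w in M.
              real (nnz (grad (fi i) (x (Suc k) w))) = d \<and>
              (\<integral>s. real (nnz (Q s (grad (fi i) (x (Suc k) w) - grad (fi i) (x k w)))) \<partial>S) = \<zeta>)
           \<longrightarrow> (\<integral>w. sent i K w \<partial>M) = d + real K * (p * d + (1 - p) * \<zeta>)))
     \<and>
     (\<gamma> = min (1 / (L * (1 + sqrt (2 * (1 - p) * \<omega> / (p * real n))))) (p / (2 * \<mu>)) \<longrightarrow>
      (\<forall>\<epsilon>. 0 < \<epsilon> \<and> \<epsilon> \<le> \<Delta>0 / 2 \<longrightarrow>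
        (\<exists>K0. real K0 \<le> 4 * (\<kappa> * ln (\<Delta>0 / \<epsilon>)) \<and>
              (\<forall>K\<ge>K0. (\<integral>w. f (x K w) - f xstar \<partial>M) \<le> \<epsilon>) \<and>
              d + real K0 * (p * d + (1 - p) * \<zeta>)
                \<le> 4 * (d + \<kappa> * (p * d + (1 - p) * \<zeta>) * ln (\<Delta>0 / \<epsilon>)))))"
proof -
  let ?a = "(1 - p) * \<omega> / (p * real n)"
  define B where "B = p * d + (1 - p) * \<zeta>"
  have ass: "2 * (1 - p) * \<omega> / (p * real n) = 2 * ?a" by simp
  interpret marina_run n fi Li L S Q \<omega> p \<gamma> \<mu> x0 xstar M c \<xi>
    using assms by unfold_locales (simp_all only: ass)
  have f_eq: "f = average_fun n fi" by (rule assms)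
  have x_eq: "x k w = fst (iter k w)" for k w
    unfolding assms(14) marina_x_def marina_eq_path iter_def draws_def[abs_def] ..
  have \<Delta>0: "\<Delta>0 = average_fun n fi x0 - average_fun n fi xstar"
    using assms by simp
  have \<zeta>: "0 \<le> \<zeta>" "(\<integral>s. real (nnz (Q s y)) \<partial>S) \<le> \<zeta>" for y
    unfolding assms(18) by (intro expected_density_nonneg expected_nnz_le_expected_density prob_space_S Q_measurable)+
  have full: "expected_density S (\<lambda>_ y :: real ^ 'd. y) = d"
    unfolding assms(19) by (rule expected_density_identity[OF prob_space_S])
  have d: "0 \<le> d" "real (nnz y) \<le> d" for y :: "real ^ 'd"
    using nnz_le_CARD[of y] by (simp_all add: assms(19))
  have B: "0 \<le> B" using p d \<zeta> by (simp add: B_def)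

  have subopt: "integrable M (\<lambda>w. f (x K w) - f xstar)"
    "(\<integral>w. f (x K w) - f xstar \<partial>M) \<le> (1 - \<gamma> * \<mu>) ^ K * \<Delta>0" for K
    using expected_suboptimality[of K] unfolding x_eq f_eq \<Delta>0 by auto

  have nominal: "integrable M (\<lambda>w. marina_nominal_cost S Q (c w) K)"
    "(\<integral>w. marina_nominal_cost S Q (c w) K \<partial>M) = d + real K * B" for K
    unfolding marina_nominal_cost_def full assms(18)[symmetric]
    using expected_coin_value[where A = d and B = \<zeta>] by (simp_all add: M.prob_space B_def)

  have sent_eq: "sent i K = (\<lambda>w. real (nnz (grad (fi i) x0)) + (\<Sum>k<K. marina_step_cost fi Q \<gamma> i (iter k w) (draws w k)))"
    if "i \<in> {1..n}" for i K
    unfolding assms(15) marina_sent_eq_path[OF that] iter_def draws_def[abs_def] ..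

  have sent: "integrable M (sent i K)" "(\<integral>w. sent i K w \<partial>M) \<le> d + real K * B"
    "(real (nnz (grad (fi i) x0)) = d \<and>
           (\<forall>k<K. AE w in M.
              real (nnz (grad (fi i) (x (Suc k) w))) = d \<and>
              (\<integral>s. real (nnz (Q s (grad (fi i) (x (Suc k) w) - grad (fi i) (x k w)))) \<partial>S) = \<zeta>)
           \<longrightarrow> (\<integral>w. sent i K w \<partial>M) = d + real K * B)"
    if i: "i \<in> {1..n}" for i K
  proof -
    note [measurable] = i
    note int = expected_step_cost(1)[OF i] and step_eq = expected_step_cost(2)[OF i, folded x_eq]
    show "integrable M (sent i K)"
      unfolding sent_eq[OF i] using int by simp
    have total: "(\<integral>w. sent i K w \<partial>M) = real (nnz (grad (fi i) x0))
        + (\<Sum>k<K. \<integral>w. marina_step_cost fi Q \<gamma> i (iter k w) (draws w k) \<partial>M)"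
      unfolding sent_eq[OF i] using int by (simp add: M.prob_space)
    \<comment> \<open>\<open>e k w\<close> is the expected cost of round \<open>k\<close> given the
      state before it.\<close>
    define e where "e k w = p * real (nnz (grad (fi i) (x (Suc k) w))) + (1 - p)
          * (\<integral>s. real (nnz (Q s (grad (fi i) (x (Suc k) w) - grad (fi i) (x k w)))) \<partial>S)" for k w
    have [measurable]: "x k \<in> borel_measurable M" for k
      unfolding x_eq[abs_def] by measurable
    have e_measurable [measurable]: "e k \<in> borel_measurable M" for k
      unfolding e_def[abs_def] by measurable
    \<comment> \<open>The supremum \<open>\<zeta>\<close> dominates the density at whichever random
      difference occurs, so the bound holds pointwise in \<open>w\<close>.\<close>
    have e_bounds: "0 \<le> e k w" "e k w \<le> B" for k w
      unfolding e_def B_def using p d \<zeta> by (auto intro!: add_nonneg_nonneg add_mono mult_left_mono)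
    have "integrable M (e k)" for k
      using e_bounds by (intro M.integrable_const_bound[where B = B]) auto
    then have "(\<integral>w. marina_step_cost fi Q \<gamma> i (iter k w) (draws w k) \<partial>M) \<le> B" for k
      unfolding step_eq e_def[symmetric] using e_bounds by (intro M.integral_le_const) auto
    then have "(\<Sum>k<K. \<integral>w. marina_step_cost fi Q \<gamma> i (iter k w) (draws w k) \<partial>M) \<le> real K * B"
      using sum_bounded_above[of "{..<K}" _ B] by simp
    then show "(\<integral>w. sent i K w \<partial>M) \<le> d + real K * B"
      unfolding total by (intro add_mono d)
    show "(real (nnz (grad (fi i) x0)) = d \<and>
           (\<forall>k<K. AE w in M.
              real (nnz (grad (fi i) (x (Suc k) w))) = d \<and>
              (\<integral>s. real (nnz (Q s (grad (fi i) (x (Suc k) w) - grad (fi i) (x k w)))) \<partial>S) = \<zeta>)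
           \<longrightarrow> (\<integral>w. sent i K w \<partial>M) = d + real K * B)"
    proof (intro impI, elim conjE)
      assume d0: "real (nnz (grad (fi i) x0)) = d"
        and tight: "\<forall>k<K. AE w in M.
              real (nnz (grad (fi i) (x (Suc k) w))) = d \<and>
              (\<integral>s. real (nnz (Q s (grad (fi i) (x (Suc k) w) - grad (fi i) (x k w)))) \<partial>S) = \<zeta>"
      have "(\<integral>w. marina_step_cost fi Q \<gamma> i (iter k w) (draws w k) \<partial>M) = B" if "k < K" for k
      proof -
        have "AE w in M. e k w = B"
          using tight[rule_format, OF that] by eventually_elim (simp add: B_def e_def)
        then have "(\<integral>w. e k w \<partial>M) = (\<integral>w. B \<partial>M)"
          by (intro integral_cong_AE) simp_all
        then show ?thesis
          unfolding step_eq e_def by (simp add: M.prob_space)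
      qed
      then show "(\<integral>w. sent i K w \<partial>M) = d + real K * B"
        unfolding total d0 by simp
    qed
  qed

  have complexity: "\<exists>K0. real K0 \<le> 4 * (\<kappa> * ln (\<Delta>0 / \<epsilon>)) \<and>
              (\<forall>K\<ge>K0. (\<integral>w. f (x K w) - f xstar \<partial>M) \<le> \<epsilon>) \<and>
              d + real K0 * B \<le> 4 * (d + \<kappa> * B * ln (\<Delta>0 / \<epsilon>))"
    if \<gamma>_eq: "\<gamma> = min (1 / (L * (1 + sqrt (2 * (1 - p) * \<omega> / (p * real n))))) (p / (2 * \<mu>))"
      and \<epsilon>: "0 < \<epsilon>" "\<epsilon> \<le> \<Delta>0 / 2" for \<epsilon>
  proof -
    have a: "0 \<le> ?a" using p \<omega>_pos by simp
    obtain K0 where K0: "real K0 \<le> 4 * (\<kappa> * ln (\<Delta>0 / \<epsilon>))"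
      and rate: "\<And>K. K0 \<le> K \<Longrightarrow> (1 - \<gamma> * \<mu>) ^ K * \<Delta>0 \<le> \<epsilon>"
      by (rule complexity_bound[OF \<mu>_pos L_pos a p \<gamma>_eq[unfolded ass] assms(17) \<epsilon>]) blast
    have "real K0 * B \<le> 4 * (\<kappa> * ln (\<Delta>0 / \<epsilon>)) * B"
      using K0 B by (rule mult_right_mono)
    \<comment> \<open>The constant 4 of the iteration count is reused, with
      \<open>d \<le> 4 * d\<close> for the initial transmission.\<close>
    then have "d + real K0 * B \<le> 4 * (d + \<kappa> * B * ln (\<Delta>0 / \<epsilon>))"
      using d(1) by (simp add: algebra_simps)
    then show ?thesis using K0 rate subopt(2) order_trans by blast
  qed
  show ?thesis
    unfolding B_def[symmetric] using subopt nominal sent complexity by blast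
qed

end
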